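(* Let $\varepsilon=\frac12$ and let $f_\varepsilon:\mathbb{T}^2\to\mathbb{T}^2$, $\mathbb{T}^2=\mathbb{R}^2/\mathbb{Z}^2$, be the standard map $$f_\varepsilon(x,y)=\left(x+y+\frac{\varepsilon}{2\pi}\sin(2\pi x)\ \mathrm{mod}\ 1,\ \ y+\frac{\varepsilon}{2\pi}\sin(2\pi x)\ \mathrm{mod}\ 1\right).$$ Then its topological entropy satisfies $h(f_\varepsilon)\ge 0.1732515918346$.
   Context: Topological entropy: for a continuous map $f:X\to X$ of a compact metric space, a set $W\subset X$ is $(n,\delta)$-separated if for any two distinct $x,y\in W$ the distance between $f^k(x)$ and $f^k(y)$ exceeds $\delta$ for some $0\le k<n$; with $s(n,\delta)$ the maximal cardinality of an $(n,\delta)$-separated set, $h(f)=\sup_{\delta>0}\limsup_{n\to\infty}\frac{\log s(n,\delta)}{n}$ (natural logarithm). *)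

theory Defs
  imports "HOL-Analysis.Analysis"
begin

section \<open>Topological entropy of a self-map of a compact metric space\<close>

definition separated :: "('a::metric_space \<Rightarrow> 'a) \<Rightarrow> nat \<Rightarrow> real \<Rightarrow> 'a set \<Rightarrow> bool" where
  "separated f n \<delta> W \<longleftrightarrow>
     (\<forall>x\<in>W. \<forall>y\<in>W. x \<noteq> y \<longrightarrow> (\<exists>k<n. dist ((f ^^ k) x) ((f ^^ k) y) > \<delta>))"

text \<open>
  The maximum is over a nonempty finite set if the space is compact, \<open>f\<close> is continuous
  and \<open>\<delta> > 0\<close>; see \<open>max_separated_well_defined\<close> below.
\<close>

definition max_separated :: "('a::metric_space \<Rightarrow> 'a) \<Rightarrow> nat \<Rightarrow> real \<Rightarrow> nat" where
  "max_separated f n \<delta> = Max {card W |W. separated f n \<delta> W}"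

definition topological_entropy :: "('a::metric_space \<Rightarrow> 'a) \<Rightarrow> ereal" where
  "topological_entropy f =
     (SUP \<delta>\<in>{0<..}. limsup (\<lambda>n. ereal (ln (real (max_separated f n \<delta>)) / real n)))"

lemma max_separated_well_defined:
  fixes f :: "'a::metric_space \<Rightarrow> 'a"
  assumes "compact (UNIV :: 'a set)" and "continuous_on UNIV f" and "\<delta> > 0"
  shows "finite {card W |W. separated f n \<delta> W}"
    and "separated f n \<delta> W \<Longrightarrow> finite W"
proof -
  have cont: "continuous_on UNIV (f ^^ k)" for k
    by (induction k) (auto intro!: continuous_on_compose2[OF assms(2)] simp: id_def o_def)
  define U where "U x = (\<Inter>k<n. (f ^^ k) -` ball ((f ^^ k) x) (\<delta>/2))" for x
  have opn: "open (U x)" for x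
    unfolding U_def
    by (intro open_INT finite_lessThan ballI open_vimage[OF open_ball cont])
  have mem: "x \<in> U x" for x using \<open>\<delta> > 0\<close> by (auto simp: U_def)
  have cov: "UNIV \<subseteq> (\<Union>x\<in>UNIV. U x)" using mem by blast
  obtain C where C: "finite C" "UNIV \<subseteq> (\<Union>x\<in>C. U x)"
    using compactE_image[OF assms(1) _ cov] opn by metis
  have bound: "finite W \<and> card W \<le> card C" if W: "separated f n \<delta> W" for W
  proof -
    have "\<forall>x. \<exists>c\<in>C. x \<in> U c" using C by blast
    then obtain g where g: "\<And>x. g x \<in> C" "\<And>x. x \<in> U (g x)" by metis
    have inj: "inj_on g W"
    proof (rule inj_onI, rule ccontr)
      fix x y assume xy: "x \<in> W" "y \<in> W" "g x = g y" "x \<noteq> y"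
      then obtain k where k: "k < n" "dist ((f ^^ k) x) ((f ^^ k) y) > \<delta>"
        using W unfolding separated_def by blast
      have "dist ((f ^^ k) (g x)) ((f ^^ k) x) < \<delta>/2" "dist ((f ^^ k) (g x)) ((f ^^ k) y) < \<delta>/2"
        using g(2)[of x] g(2)[of y] k(1) xy(3) by (auto simp: U_def)
      then have "dist ((f ^^ k) x) ((f ^^ k) y) < \<delta>"
        by (rule dist_triangle_half_r)
      with k show False by simp
    qed
    then show ?thesis
      using C(1) g(1) by (meson card_inj_on_le image_subsetI inj_on_finite)
  qed
  show "separated f n \<delta> W \<Longrightarrow> finite W" using bound by blast
  show "finite {card W |W. separated f n \<delta> W}"
    by (rule finite_subset[of _ "{..card C}"]) (use bound in auto)
qed


section \<open>The torus \<open>\<real>\<^sup>2/\<int>\<^sup>2\<close> with its quotient metric\<close>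

quotient_type torus = "real \<times> real" /
  "\<lambda>p q. fst p - fst q \<in> \<int> \<and> snd p - snd q \<in> \<int>"
  morphisms rep_torus to_torus
proof (rule equivpI)
  show "reflp (\<lambda>p q :: real \<times> real. fst p - fst q \<in> \<int> \<and> snd p - snd q \<in> \<int>)"
    by (auto intro: reflpI)
  show "symp (\<lambda>p q :: real \<times> real. fst p - fst q \<in> \<int> \<and> snd p - snd q \<in> \<int>)"
    by (rule sympI) (metis Ints_minus minus_diff_eq)
  show "transp (\<lambda>p q :: real \<times> real. fst p - fst q \<in> \<int> \<and> snd p - snd q \<in> \<int>)"
  proof (rule transpI)
    fix x y z :: "real \<times> real"
    assume "fst x - fst y \<in> \<int> \<and> snd x - snd y \<in> \<int>" "fst y - fst z \<in> \<int> \<and> snd y - snd z \<in> \<int>"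
    then have "(fst x - fst y) + (fst y - fst z) \<in> \<int> \<and> (snd x - snd y) + (snd y - snd z) \<in> \<int>"
      by (blast intro: Ints_add)
    then show "fst x - fst z \<in> \<int> \<and> snd x - snd z \<in> \<int>" by simp
  qed
qed

lemma to_torus_eq_iff:
  "to_torus p = to_torus q \<longleftrightarrow> fst p - fst q \<in> \<int> \<and> snd p - snd q \<in> \<int>"
  using torus.abs_eq_iff[of p q] by simp

lemma to_torus_surj: "\<exists>p. to_torus p = P"
  by (induct P rule: torus.abs_induct) blast

lemma to_torus_translate:
  assumes "to_torus p = to_torus q"
  shows "to_torus (p + r) = to_torus (q + r)"
  using assms by (simp add: to_torus_eq_iff)

text \<open>
  The distance of two points of the torus is the least Euclidean distance of their lifts.
\<close>

instantiation torus :: metric_space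
begin

definition dist_torus :: "torus \<Rightarrow> torus \<Rightarrow> real" where
  "dist (P :: torus) (Q :: torus) = Inf {dist p q |p q. to_torus p = P \<and> to_torus q = Q}"

definition uniformity_torus :: "(torus \<times> torus) filter" where
  "uniformity = (INF e\<in>{0<..}. principal {(P :: torus, Q). dist P Q < e})"

definition open_torus :: "torus set \<Rightarrow> bool" where
  "open (U :: torus set) \<longleftrightarrow> (\<forall>P\<in>U. \<forall>\<^sub>F (P', Q) in uniformity. P' = P \<longrightarrow> Q \<in> U)"

lemma dist_to_torus: "dist (to_torus p) Q = infdist p {q. to_torus q = Q}"
proof -
  have "{dist p' q |p' q. to_torus p' = to_torus p \<and> to_torus q = Q}
        = dist p ` {q. to_torus q = Q}" (is "?A = ?B")
  proof
    show "?A \<subseteq> ?B"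
    proof
      fix d assume "d \<in> ?A"
      then obtain p' q where d: "d = dist p' q" "to_torus p' = to_torus p" "to_torus q = Q"
        by blast
      have "to_torus (p' + (q - p')) = to_torus (p + (q - p'))"
        using d(2) by (rule to_torus_translate)
      then have "to_torus (p + (q - p')) = Q" using d(3) by simp
      moreover have "d = dist p (p + (q - p'))" by (simp add: d(1) dist_norm norm_minus_commute)
      ultimately show "d \<in> ?B" by blast
    qed
  qed blast
  moreover have "{q. to_torus q = Q} \<noteq> {}" using to_torus_surj[of Q] by blast
  ultimately show ?thesis by (simp only: dist_torus_def infdist_def if_False)
qed

lemma dist_to_torus_le: "dist (to_torus p) (to_torus q) \<le> dist p q"
  by (simp add: dist_to_torus infdist_le)

lemma dist_to_torus_less:
  assumes "dist (to_torus p) Q < e"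
  obtains q where "to_torus q = Q" "dist p q < e"
proof -
  have ne: "{q. to_torus q = Q} \<noteq> {}" using to_torus_surj[of Q] by blast
  have "(INF q\<in>{q. to_torus q = Q}. dist p q) < e"
    using assms ne by (simp only: dist_to_torus infdist_def if_False)
  then show thesis
    using that ne cInf_lessD[of "dist p ` {q. to_torus q = Q}" e] by auto
qed

instance
proof
  show "dist P Q = 0 \<longleftrightarrow> P = Q" for P Q :: torus
  proof -
    obtain p where p: "to_torus p = P" using to_torus_surj by blast
    obtain q where q: "to_torus q = Q" using to_torus_surj by blast
    have "{r. to_torus r = Q} = (\<lambda>r. fst r - fst q) -` \<int> \<inter> (\<lambda>r. snd r - snd q) -` \<int>"
      by (auto simp: to_torus_eq_iff simp flip: q)
    then have "closed {r. to_torus r = Q}"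
      by (auto intro!: closed_Int closed_vimage closed_Ints continuous_intros)
    then have "dist P Q = 0 \<longleftrightarrow> p \<in> {r. to_torus r = Q}"
      unfolding p[symmetric] dist_to_torus
      by (subst in_closed_iff_infdist_zero) (use q in blast)+
    then show ?thesis using p by simp
  qed
  show "dist P Q \<le> dist P R + dist Q R" for P Q R :: torus
  proof (rule field_le_epsilon)
    fix e :: real assume e: "e > 0"
    obtain r where r: "to_torus r = R" using to_torus_surj by blast
    have comm: "dist P Q = dist Q P" for P Q :: torus
      unfolding dist_torus_def by (metis dist_commute)
    obtain p where p: "to_torus p = P" "dist r p < dist P R + e/2"
      using dist_to_torus_less[of r P "dist P R + e/2"] comm[of P R] r e by auto
    obtain q where q: "to_torus q = Q" "dist r q < dist Q R + e/2"
      using dist_to_torus_less[of r Q "dist Q R + e/2"] comm[of Q R] r e by auto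
    have "dist P Q \<le> dist p q" using dist_to_torus_le p q by blast
    also have "\<dots> \<le> dist r p + dist r q" by (metis dist_commute dist_triangle)
    finally show "dist P Q \<le> dist P R + dist Q R + e" using p q by linarith
  qed
qed (simp_all only: uniformity_torus_def open_torus_def)

end

lemma compact_torus: "compact (UNIV :: torus set)"
proof -
  have "continuous_on S to_torus" for S
    unfolding continuous_on_iff by (meson dist_to_torus_le le_less_trans)
  then have "compact (to_torus ` cbox (0, 0) (1, 1))"
    by (intro compact_continuous_image compact_cbox)
  moreover have "P \<in> to_torus ` cbox (0, 0) (1, 1)" for P
  proof -
    obtain p where p: "to_torus p = P" using to_torus_surj by blast
    have "to_torus (frac (fst p), frac (snd p)) = P"
      by (simp add: to_torus_eq_iff frac_def flip: p)
    moreover have "(frac (fst p), frac (snd p)) \<in> cbox (0, 0) (1, 1 :: real)"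
      by (simp add: cbox_Pair_eq frac_lt_1 less_imp_le)
    ultimately show ?thesis by (metis image_eqI)
  qed
  ultimately show ?thesis by (metis UNIV_eq_I)
qed


section \<open>The standard map\<close>

lift_definition standard_map :: "real \<Rightarrow> torus \<Rightarrow> torus" is
  "\<lambda>\<epsilon> (x, y). (x + y + \<epsilon> / (2 * pi) * sin (2 * pi * x), y + \<epsilon> / (2 * pi) * sin (2 * pi * x))"
proof -
  fix \<epsilon> :: real and p q :: "real \<times> real"
  obtain x y x' y' where pq: "p = (x, y)" "q = (x', y')" by (cases p, cases q)
  assume "fst p - fst q \<in> \<int> \<and> snd p - snd q \<in> \<int>"
  then obtain i j where "x - x' = of_int i" "y - y' = of_int j"
    unfolding pq by (auto elim!: Ints_cases)
  then have ij: "x = x' + of_int i" "y = y' + of_int j" by auto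
  have "sin (2 * pi * x' + 2 * pi * of_int i) = sin (2 * pi * x')"
    by (simp add: sin_add cos_int_2pin sin_int_2pin)
  then have s: "sin (2 * pi * x) = sin (2 * pi * x')" by (simp add: ij distrib_left)
  show "fst (case p of (x, y) \<Rightarrow> (x + y + \<epsilon> / (2 * pi) * sin (2 * pi * x), y + \<epsilon> / (2 * pi) * sin (2 * pi * x)))
        - fst (case q of (x, y) \<Rightarrow> (x + y + \<epsilon> / (2 * pi) * sin (2 * pi * x), y + \<epsilon> / (2 * pi) * sin (2 * pi * x))) \<in> \<int> \<and>
      snd (case p of (x, y) \<Rightarrow> (x + y + \<epsilon> / (2 * pi) * sin (2 * pi * x), y + \<epsilon> / (2 * pi) * sin (2 * pi * x)))
        - snd (case q of (x, y) \<Rightarrow> (x + y + \<epsilon> / (2 * pi) * sin (2 * pi * x), y + \<epsilon> / (2 * pi) * sin (2 * pi * x))) \<in> \<int>"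
    unfolding pq by (simp add: s) (simp add: ij)
qed

lemma standard_map_to_torus:
  "standard_map \<epsilon> (to_torus (x, y)) =
     to_torus (x + y + \<epsilon> / (2 * pi) * sin (2 * pi * x), y + \<epsilon> / (2 * pi) * sin (2 * pi * x))"
  by (simp add: standard_map.abs_eq)

lemma continuous_standard_map: "continuous_on UNIV (standard_map \<epsilon>)"
  unfolding continuous_on_iff
proof (intro ballI allI impI)
  fix P :: torus and e :: real assume e: "e > 0"
  define F where "F = (\<lambda>p. (fst p + snd p + \<epsilon> / (2 * pi) * sin (2 * pi * fst p),
                            snd p + \<epsilon> / (2 * pi) * sin (2 * pi * fst p)))"
  have F: "standard_map \<epsilon> (to_torus p) = to_torus (F p)" for p
    by (cases p) (simp add: F_def standard_map_to_torus)
  have cont: "continuous_on UNIV F" unfolding F_def by (intro continuous_intros)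
  obtain p where p: "to_torus p = P" using to_torus_surj by blast
  obtain d where d: "d > 0" "\<And>q. dist q p < d \<Longrightarrow> dist (F q) (F p) < e"
    using cont e unfolding continuous_on_iff by (metis UNIV_I)
  have "dist (standard_map \<epsilon> Q) (standard_map \<epsilon> P) < e" if QP: "dist Q P < d" for Q
  proof -
    obtain q where q: "to_torus q = Q" "dist p q < d"
      using dist_to_torus_less[of p Q d] QP unfolding p by (metis dist_commute)
    have "dist (standard_map \<epsilon> Q) (standard_map \<epsilon> P) \<le> dist (F q) (F p)"
      by (metis F dist_to_torus_le p q(1))
    also have "\<dots> < e" using d(2)[of q] q(2) by (simp only: dist_commute)
    finally show ?thesis .
  qed
  with d(1) show "\<exists>d>0. \<forall>Q\<in>UNIV. dist Q P < d \<longrightarrow> dist (standard_map \<epsilon> Q) (standard_map \<epsilon> P) < e"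
    by blast
qed

end

theory Submission imports Defs begin

text \<open>
  In the angles \<open>X = 2 \<pi> x\<close>, \<open>Y = 2 \<pi> y\<close> the map lifts to
  \<open>(X, Y) \<mapsto> (X + Y', Y')\<close> with \<open>Y' = Y + sin X / 2\<close>. The origin is a hyperbolic fixed point with
  eigenvalues \<open>2\<close> and \<open>1/2\<close>; \<open>X + Y\<close> is its expanding and \<open>X - 2 Y\<close> its contracting eigencoordinate.
  Its unstable manifold leaves to the right, travels once around the circle and crosses the stable
  manifold of the translated fixed point \<open>(2 \<pi>, 0)\<close>. Two of the resulting homoclinic orbits are
  symmetric under the reversing symmetry \<open>X \<mapsto> 2 \<pi> - X\<close>: one passes exactly through \<open>X = \<pi>\<close> (``site''), the
  other has two consecutive points symmetric about \<open>\<pi>\<close> (``bond''); the mirror image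
  \<open>(X, Y) \<mapsto> (-X, -Y)\<close> adds two more, which travel to the left.

  Take a small box \<open>P\<close> around the saddle, with sides along the eigendirections. Points of \<open>P\<close> close
  to the contracting axis are mapped across \<open>P\<close> by a single step. Points in a thin strip around the
  bond orbit return after 19 steps, those in a strip around the site orbit after 18 steps, and
  the image of each strip crosses \<open>P\<close> completely in the expanding direction, because the stable and
  unstable manifolds cross there. Together with the mirror images this gives five disjoint strips
  of \<open>P\<close> with return times \<open>1, 18, 18, 19, 19\<close>.

  Crossing is all that is needed to realize every itinerary: a curve in \<open>P\<close> that joins the two
  ends contains a subcurve inside any chosen strip whose image again joins the two ends
  (\<open>itinerary_on_crossing_curve\<close>, by the intermediate value theorem). Different itineraries separate at a definite distance, so the
  number of separated orbits grows at least like \<open>exp (h n)\<close> as soon as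
  \<open>exp (-h) + 2 exp (-18 h) + 2 exp (-19 h) \<ge> 1\<close> (\<open>entropy_ge_return_words\<close>), and
  \<open>h = 0.1732515918346\<close> satisfies this inequality.

  What remains is to verify that the two strips do return across \<open>P\<close>. The homoclinic lobes are only
  about \<open>1 / 10 ^ 3\<close> wide, whereas the image of a strip becomes about \<open>9 / 10 ^ 2\<close> long and bends by
  several times its own thickness. The strip is therefore enclosed by
  quadratically curved tubes \<open>c + e \<sigma> + q \<sigma>\<^sup>2 + g t + h r\<close>, in which the longitudinal parameter
  \<open>\<sigma>\<close> of the initial strip is kept throughout and the errors are collected in the parallelogram spanned by
  \<open>g\<close> and \<open>h\<close>. Passing from one tube to the next is a finite set of inequalities between integers
  (\<open>step_ok\<close>), whose soundness is \<open>step_ok_sound\<close>; a whole excursion is a list of 19 or 20 tubes.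
\<close>

section \<open>Entropy from freely concatenable return words\<close>

primrec follows :: "('i \<Rightarrow> 'a \<Rightarrow> 'a) \<Rightarrow> ('i \<Rightarrow> 'a set) \<Rightarrow> 'a \<Rightarrow> 'i list \<Rightarrow> bool" where
  "follows G E x [] \<longleftrightarrow> True"
| "follows G E x (i # w) \<longleftrightarrow> x \<in> E i \<and> follows G E (G i x) w"

lemma follows_append_Cons:
  assumes "follows (\<lambda>i. f ^^ N i) E x (u @ i # v)"
  shows "(f ^^ sum_list (map N u)) x \<in> E i"
  using assms
proof (induction u arbitrary: x)
  case Nil
  then show ?case by simp
next
  case (Cons j u)
  then have "(f ^^ sum_list (map N u)) ((f ^^ N j) x) \<in> E i" by simp
  then show ?case by (simp add: funpow_add add.commute[of "N j"])
qed

text \<open>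
  A tree of words, cut off as soon as the total return time reaches \<open>n\<close>. Two different words of the
  tree split at a node whose return time is still less than \<open>n\<close>, which is what makes the
  corresponding orbits \<open>n\<close>-separated. The lower bound for their number is the recursion
  \<open>a n = (\<Sum>i\<in>I. a (n - N i))\<close>; the truncated subtraction only helps, since \<open>h \<ge> 0\<close>.
\<close>

lemma many_words:
  fixes N :: "'i \<Rightarrow> nat" and h :: real
  assumes "finite I" "\<And>i. i \<in> I \<Longrightarrow> N i > 0" and h: "h \<ge> 0" "1 \<le> (\<Sum>i\<in>I. exp (- h * N i))"
  shows "\<exists>S. finite S \<and> S \<subseteq> lists I \<and> exp (h * n) \<le> card S \<and>
    (\<forall>w\<in>S. \<forall>w'\<in>S. w \<noteq> w' \<longrightarrow> (\<exists>u i v j v'. w = u @ i # v \<and> w' = u @ j # v' \<and> i \<noteq> j \<and>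
        sum_list (map N u) < n))"
proof (induction n rule: less_induct)
  case (less n)
  show ?case
  proof (cases "n = 0")
    case True
    then show ?thesis by (intro exI[of _ "{[]}"]) simp
  next
    case False
    \<comment> \<open>One subtree for each first letter.\<close>
    have "\<forall>i\<in>I. \<exists>S. finite S \<and> S \<subseteq> lists I \<and> exp (h * (n - N i)) \<le> card S \<and>
      (\<forall>w\<in>S. \<forall>w'\<in>S. w \<noteq> w' \<longrightarrow> (\<exists>u i' v j v'. w = u @ i' # v \<and> w' = u @ j # v' \<and> i' \<noteq> j \<and>
        sum_list (map N u) < n - N i))"
    proof
      fix i assume "i \<in> I"
      then have "n - N i < n" using False assms(2) by simp
      then show "\<exists>S. finite S \<and> S \<subseteq> lists I \<and> exp (h * (n - N i)) \<le> card S \<and>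
        (\<forall>w\<in>S. \<forall>w'\<in>S. w \<noteq> w' \<longrightarrow> (\<exists>u i' v j v'. w = u @ i' # v \<and> w' = u @ j # v' \<and> i' \<noteq> j \<and>
        sum_list (map N u) < n - N i))" by (rule less.IH)
    qed
    from bchoice[OF this] obtain S where *: "\<forall>i\<in>I. finite (S i) \<and> S i \<subseteq> lists I \<and>
        exp (h * (n - N i)) \<le> card (S i) \<and>
        (\<forall>w\<in>S i. \<forall>w'\<in>S i. w \<noteq> w' \<longrightarrow>
          (\<exists>u i' v j v'. w = u @ i' # v \<and> w' = u @ j # v' \<and> i' \<noteq> j \<and> sum_list (map N u) < n - N i))" ..
    then have S: "\<And>i. i \<in> I \<Longrightarrow> finite (S i)" "\<And>i. i \<in> I \<Longrightarrow> S i \<subseteq> lists I"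
      "\<And>i. i \<in> I \<Longrightarrow> exp (h * (n - N i)) \<le> card (S i)"
      by simp_all
    have split: "\<exists>u i' v j v'. w = u @ i' # v \<and> w' = u @ j # v' \<and> i' \<noteq> j \<and> sum_list (map N u) < n - N i"
      if "i \<in> I" "w \<in> S i" "w' \<in> S i" "w \<noteq> w'" for i w w'
      using * that by simp
    let ?S = "\<Union>i\<in>I. (#) i ` S i"
    have "exp (h * n) \<le> exp (h * n) * (\<Sum>i\<in>I. exp (- h * N i))"
      using h(2) by simp
    also have "\<dots> = (\<Sum>i\<in>I. exp (h * (real n - N i)))"
      unfolding sum_distrib_left
      by (rule sum.cong) (simp_all add: right_diff_distrib flip: exp_add)
    also have "\<dots> \<le> (\<Sum>i\<in>I. real (card (S i)))"
    proof (rule sum_mono)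
      fix i assume i: "i \<in> I"
      have "h * (real n - real (N i)) \<le> h * real (n - N i)"
        by (intro mult_left_mono h(1)) simp
      then show "exp (h * (real n - real (N i))) \<le> real (card (S i))"
        using S(3)[OF i] by (meson exp_le_cancel_iff order_trans)
    qed
    also have "\<dots> = card ?S"
      using assms(1) S(1)
      by (subst card_UN_disjoint) (auto simp: card_image)
    finally have card: "exp (h * n) \<le> card ?S" .
    have fin: "finite ?S" using assms(1) S(1) by simp
    have sub: "?S \<subseteq> lists I" 
    proof (rule UN_least)
      fix i assume i: "i \<in> I"
      show "(#) i ` S i \<subseteq> lists I"
      proof (rule image_subsetI)
        fix w assume "w \<in> S i"
        then have "w \<in> lists I" using S(2)[OF i] by (rule subsetD[rotated])
        with i show "i # w \<in> lists I" by (rule lists.Cons)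
      qed
    qed
    have split_S: "\<exists>u i v j v'. w = u @ i # v \<and> w' = u @ j # v' \<and> i \<noteq> j \<and> sum_list (map N u) < n"
      if "w \<in> ?S" "w' \<in> ?S" "w \<noteq> w'" for w w'
    proof -
      obtain i v where w: "i \<in> I" "w = i # v" "v \<in> S i" using \<open>w \<in> ?S\<close> by blast
      obtain j v' where w': "j \<in> I" "w' = j # v'" "v' \<in> S j" using \<open>w' \<in> ?S\<close> by blast
      show ?thesis
      proof (cases "i = j")
        case True
        then have "v' \<in> S i" "v \<noteq> v'" using w w' \<open>w \<noteq> w'\<close> by simp_all
        from split[OF w(1,3) this] obtain u k x l y where *:
          "v = u @ k # x" "v' = u @ l # y" "k \<noteq> l" "sum_list (map N u) < n - N i"
          by blast
        have "w = (i # u) @ k # x" "w' = (i # u) @ l # y" "sum_list (map N (i # u)) < n"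
          using * w(2) w'(2) True by simp_all
        with *(3) show ?thesis by blast
      next
        case False
        then have "w = [] @ i # v \<and> w' = [] @ j # v' \<and> i \<noteq> j \<and> sum_list (map N []) < n"
          using w w' \<open>n \<noteq> 0\<close> by simp
        then show ?thesis by blast
      qed
    qed
    show ?thesis
      by (rule exI[of _ ?S], intro conjI fin sub card ballI impI, rule split_S)
  qed
qed

text \<open>
  A horseshoe whose branches have different return times: \<open>E i\<close> returns to the family \<open>E\<close> after \<open>N i\<close>
  steps. Orbits with the same initial word are synchronous, so at the first
  letter where two words differ both orbits are inspected at the same time and lie in different sets of the
  family.
\<close>

lemma entropy_ge_return_words:
  fixes f :: "'a::metric_space \<Rightarrow> 'a" and N :: "'i \<Rightarrow> nat" and h :: real
  assumes X: "compact (UNIV :: 'a set)" "continuous_on UNIV f"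
    and I: "finite I" "\<And>i. i \<in> I \<Longrightarrow> N i > 0"
    and \<delta>: "\<delta> > 0" "\<And>i j x y. i \<in> I \<Longrightarrow> j \<in> I \<Longrightarrow> i \<noteq> j \<Longrightarrow> x \<in> E i \<Longrightarrow> y \<in> E j \<Longrightarrow> dist x y > \<delta>"
    and real: "\<And>w. w \<in> lists I \<Longrightarrow> \<exists>x. follows (\<lambda>i. f ^^ N i) E x w"
    and h: "h \<ge> 0" "1 \<le> (\<Sum>i\<in>I. exp (- h * N i))"
  shows "ereal h \<le> topological_entropy f"
proof -
  have max: "exp (h * n) \<le> max_separated f n \<delta>" for n
  proof -
    from many_words[OF I h, of n] obtain S where *: "finite S \<and> S \<subseteq> lists I \<and> exp (h * n) \<le> card S \<and>
      (\<forall>w\<in>S. \<forall>w'\<in>S. w \<noteq> w' \<longrightarrow> (\<exists>u i v j v'. w = u @ i # v \<and> w' = u @ j # v' \<and> i \<noteq> j \<and>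
        sum_list (map N u) < n))" ..
    then have S: "finite S" "S \<subseteq> lists I" "exp (h * n) \<le> card S" by simp_all
    have split: "\<exists>u i v j v'. w = u @ i # v \<and> w' = u @ j # v' \<and> i \<noteq> j \<and> sum_list (map N u) < n"
      if "w \<in> S" "w' \<in> S" "w \<noteq> w'" for w w'
      using * that by simp
    have "\<forall>w\<in>S. \<exists>x. follows (\<lambda>i. f ^^ N i) E x w" using real S(2) by (metis subsetD)
    from bchoice[OF this] obtain x where x: "\<And>w. w \<in> S \<Longrightarrow> follows (\<lambda>i. f ^^ N i) E (x w) w" by blast
    have far: "\<exists>k<n. dist ((f ^^ k) (x w)) ((f ^^ k) (x w')) > \<delta>"
      if ww': "w \<in> S" "w' \<in> S" "w \<noteq> w'" for w w'
    proof -
      obtain u i v j v' where *: "w = u @ i # v" "w' = u @ j # v'" "i \<noteq> j" "sum_list (map N u) < n"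
        using split[OF ww'] by blast
      have "i \<in> I" "j \<in> I" using ww'(1,2) S(2) *(1,2) by auto
      moreover have "(f ^^ sum_list (map N u)) (x w) \<in> E i"
        using x[OF ww'(1)] unfolding *(1) by (rule follows_append_Cons)
      moreover have "(f ^^ sum_list (map N u)) (x w') \<in> E j"
        using x[OF ww'(2)] unfolding *(2) by (rule follows_append_Cons)
      ultimately show ?thesis using \<delta>(2) *(3,4) by blast
    qed
    have "inj_on x S"
      by (rule inj_onI, rule ccontr) (use far \<delta>(1) in fastforce)
    then have "card (x ` S) = card S" by (rule card_image)
    moreover have "separated f n \<delta> (x ` S)" unfolding separated_def using far by blast
    ultimately have "card S \<in> {card W |W. separated f n \<delta> W}" by (metis (mono_tags) mem_Collect_eq)
    then have "card S \<le> max_separated f n \<delta>"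
      unfolding max_separated_def
      using max_separated_well_defined(1)[OF X \<delta>(1)] by (rule Max_ge[rotated])
    with S(3) show ?thesis by linarith
  qed
  have "ereal h \<le> ereal (ln (real (max_separated f n \<delta>)) / real n)" if "n > 0" for n
  proof -
    have "h * n \<le> ln (real (max_separated f n \<delta>))"
      using max[of n] by (metis exp_gt_zero ln_exp ln_mono order_less_le_trans)
    then show ?thesis using that by (simp add: pos_le_divide_eq)
  qed
  then have "eventually (\<lambda>n. ereal h \<le> ereal (ln (real (max_separated f n \<delta>)) / real n)) sequentially"
    using eventually_gt_at_top[of 0] by (rule eventually_mono[rotated])
  then have "limsup (\<lambda>n. ereal h) \<le> limsup (\<lambda>n. ereal (ln (real (max_separated f n \<delta>)) / real n))"
    by (rule Limsup_mono)
  then have "ereal h \<le> limsup (\<lambda>n. ereal (ln (real (max_separated f n \<delta>)) / real n))"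
    by (simp add: Limsup_const)
  also have "\<dots> \<le> topological_entropy f"
    unfolding topological_entropy_def using \<delta>(1) by (intro SUP_upper) simp
  finally show ?thesis .
qed

lemma follows_image:
  assumes "follows G E x w" "\<And>i x. \<pi> (G i x) = H i (\<pi> x)"
  shows "follows H (\<lambda>i. \<pi> ` E i) (\<pi> x) w"
  using assms(1) by (induction w arbitrary: x) (auto simp: assms(2)[symmetric])

section \<open>Certified values of sine and cosine\<close>

lemma sin_add_quadratic:
  fixes x y :: real
  shows "\<bar>sin (x + y) - (sin x + y * cos x - y\<^sup>2 / 2 * sin x)\<bar> \<le> \<bar>y\<bar> ^ 3 / 6"
proof -
  define d where "d m t = sin (x + t + real m * pi / 2)" for m :: nat and t
  have "\<exists>t. \<bar>t\<bar> \<le> \<bar>y\<bar> \<and>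
      sin (x + y) = (\<Sum>m<3. d m 0 / fact m * y ^ m) + d 3 t / fact 3 * y ^ 3"
  proof (rule Maclaurin_all_le)
    show "d 0 = (\<lambda>y. sin (x + y))" by (simp add: d_def fun_eq_iff)
    show "\<forall>m t. DERIV (d m) t :> d (Suc m) t"
    proof (intro allI)
      fix m t
      have "DERIV (d m) t :> cos (x + t + real m * pi / 2)"
        unfolding d_def by (auto intro!: derivative_eq_intros)
      moreover have "cos (x + t + real m * pi / 2) = d (Suc m) t"
        using sin_add[of "x + t + real m * pi / 2" "pi / 2"]
        by (simp add: d_def field_simps)
      ultimately show "DERIV (d m) t :> d (Suc m) t" by simp
    qed
  qed
  then obtain t where t: "sin (x + y) =
      (\<Sum>m<3. d m 0 / fact m * y ^ m) + d 3 t / fact 3 * y ^ 3" by blast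
  have "d 0 0 = sin x" "d 1 0 = cos x" "d 2 0 = - sin x"
    by (simp_all add: d_def sin_add)
  then have "sin (x + y) - (sin x + y * cos x - y\<^sup>2 / 2 * sin x) = d 3 t * y ^ 3 / 6"
    unfolding t by (simp add: eval_nat_numeral lessThan_Suc)
  moreover have "\<bar>d 3 t\<bar> * \<bar>y\<bar> ^ 3 \<le> 1 * \<bar>y\<bar> ^ 3"
    by (rule mult_right_mono) (simp_all add: d_def)
  ultimately show ?thesis by (simp only: abs_mult power_abs abs_divide)
qed

text \<open>
  The fraction \<open>a / b\<close> obtained from \<open>horner p q m n = (a, b)\<close> is the alternating series
  \<open>1 - y / ((m+1) (m+2)) * (1 - y / ((m+3) (m+4)) * \<dots>)\<close> in \<open>y = p / q\<close> with \<open>n\<close> nested terms: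
  the cosine series for \<open>m = 0\<close> and the sine series divided by its argument for \<open>m = 1\<close>, if \<open>y\<close> is
  the square of the argument. Numerator and denominator are kept apart in order to compute
  with integers only.
\<close>

fun horner :: "int \<Rightarrow> int \<Rightarrow> int \<Rightarrow> nat \<Rightarrow> int \<times> int" where
  "horner p q m 0 = (1, 1)"
| "horner p q m (Suc n) = (case horner p q (m + 2) n of (a, b) \<Rightarrow>
     ((m + 1) * (m + 2) * q * b - p * a, (m + 1) * (m + 2) * q * b))"

lemma horner_eq_sum:
  assumes "q > 0" "horner p q (int m) n = (a, b)"
  shows "b > 0 \<and> real_of_int a / real_of_int b =
    (\<Sum>i\<le>n. (- (p / q)) ^ i * (fact m / fact (m + 2 * i)))"
  using assms(2)
proof (induction n arbitrary: m a b)
  case 0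
  then show ?case by simp
next
  case (Suc n)
  let ?y = "real_of_int p / real_of_int q"
  obtain a' b' where ab': "horner p q (int (m + 2)) n = (a', b')" by fastforce
  have ab: "a = (int m + 1) * (int m + 2) * q * b' - p * a'"
    "b = (int m + 1) * (int m + 2) * q * b'"
    using Suc.prems ab' by (simp_all add: add.commute)
  have IH: "b' > 0" "real_of_int a' / real_of_int b' =
    (\<Sum>i\<le>n. (- ?y) ^ i * (fact (m + 2) / fact (m + 2 + 2 * i)))"
    using Suc.IH[OF ab'] by auto
  have fact_step: "fact (m + 2) = (real m + 1) * (real m + 2) * fact m"
    by (simp add: fact_reduce algebra_simps)
  have "real_of_int a / real_of_int b =
      1 - ?y / ((real m + 1) * (real m + 2)) * (real_of_int a' / real_of_int b')"
    using IH(1) assms(1) unfolding ab by (simp add: diff_divide_distrib)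
  also have "\<dots> = 1 + (\<Sum>i\<le>n. (- ?y) ^ Suc i * (fact m / fact (m + 2 * Suc i)))"
  proof -
    have "M \<noteq> 0 \<Longrightarrow> - (y / M * (r * (M * f / g))) = - y * r * (f / g)" for M y r f g :: real
      by simp
    from this[of "(real m + 1) * (real m + 2)"]
    have "- (?y / ((real m + 1) * (real m + 2)) * ((- ?y) ^ i * (fact (m + 2) / fact (m + 2 + 2 * i)))) =
        (- ?y) ^ Suc i * (fact m / fact (m + 2 * Suc i))" for i
      unfolding fact_step by (simp add: add_nonneg_eq_0_iff del: fact_Suc)
    then show ?thesis
      unfolding IH(2) sum_distrib_left diff_conv_add_uminus sum_negf[symmetric] by simp
  qed
  also have "\<dots> = (\<Sum>i\<le>Suc n. (- ?y) ^ i * (fact m / fact (m + 2 * i)))"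
    by (subst sum.atMost_Suc_shift) simp
  finally show ?case using IH(1) assms(1) by (simp add: ab)
qed

lemma power_minus_square: "(- (x * x)) ^ k = (-1) ^ k * x ^ (2 * k)" for x :: real
  by (subst power_minus) (simp add: power_mult power2_eq_square)

lemma sin_partial_sum:
  "(\<Sum>m<2 * n + 3. sin_coeff m * x ^ m) = x * (\<Sum>i\<le>n. (- (x * x)) ^ i * (fact 1 / fact (1 + 2 * i)))"
proof (induction n)
  case 0
  then show ?case by (simp add: eval_nat_numeral sin_coeff_def)
next
  case (Suc n)
  have "(\<Sum>m<2 * Suc n + 3. sin_coeff m * x ^ m) =
      (\<Sum>m<2 * n + 3. sin_coeff m * x ^ m) + sin_coeff (2 * n + 3) * x ^ (2 * n + 3)
      + sin_coeff (2 * n + 4) * x ^ (2 * n + 4)"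
    by (simp add: eval_nat_numeral)
  moreover have "sin_coeff (2 * n + 3) * x ^ (2 * n + 3) =
      x * ((- (x * x)) ^ Suc n * (fact 1 / fact (1 + 2 * Suc n)))"
  proof -
    have "sin_coeff (Suc (2 * k)) = (-1) ^ k / fact (Suc (2 * k))" for k
      by (simp add: sin_coeff_def del: fact_Suc)
    from this[of "Suc n"] have "sin_coeff (2 * n + 3) = (-1) ^ Suc n / fact (2 * n + 3)"
      by (simp add: eval_nat_numeral del: fact_Suc)
    moreover have "1 + 2 * Suc n = 2 * n + 3" "x ^ (2 * n + 3) = x * x ^ (2 * Suc n)"
      by (simp_all add: eval_nat_numeral)
    ultimately show ?thesis
      unfolding power_minus_square by (simp only: times_divide_eq_right times_divide_eq_left) simp
  qed
  ultimately show ?case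
    unfolding Suc.IH by (simp add: sin_coeff_def distrib_left del: fact_Suc power_Suc)
qed

lemma cos_partial_sum:
  "(\<Sum>m<2 * n + 2. cos_coeff m * x ^ m) = (\<Sum>i\<le>n. (- (x * x)) ^ i * (fact 0 / fact (0 + 2 * i)))"
proof (induction n)
  case 0
  then show ?case by (simp add: eval_nat_numeral cos_coeff_def)
next
  case (Suc n)
  have "(\<Sum>m<2 * Suc n + 2. cos_coeff m * x ^ m) =
      (\<Sum>m<2 * n + 2. cos_coeff m * x ^ m) + cos_coeff (2 * n + 2) * x ^ (2 * n + 2)
      + cos_coeff (2 * n + 3) * x ^ (2 * n + 3)"
    by (simp add: eval_nat_numeral)
  moreover have "cos_coeff (2 * n + 2) * x ^ (2 * n + 2) =
      (- (x * x)) ^ Suc n * (fact 0 / fact (0 + 2 * Suc n))"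
  proof -
    have "2 * n + 2 = 2 * Suc n" by simp
    then show ?thesis
      unfolding power_minus_square by (simp add: cos_coeff_def del: fact_Suc mult_Suc_right)
  qed
  ultimately show ?case
    unfolding Suc.IH by (simp add: cos_coeff_def distrib_left del: fact_Suc power_Suc)
qed

text \<open>
  The fixed-point numbers \<open>s\<close> and \<open>k\<close>, in units of \<open>1 / 10 ^ 8\<close>, approximate half the sine and half the
  cosine of \<open>x / 10 ^ 3\<close>. The comparison with the Taylor polynomial leaves a tenth of a unit for its
  truncation error; the bound on \<open>x\<close> covers arguments slightly beyond \<open>\<pi>\<close>.
\<close>

definition trig_ok :: "int \<Rightarrow> int \<Rightarrow> int \<Rightarrow> bool" where
  "trig_ok x s k \<longleftrightarrow> \<bar>x\<bar> \<le> 3200 \<and>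
     (case horner (x * x) (10 ^ 6) 1 10 of (a, b) \<Rightarrow>
        10 * \<bar>10 ^ 8 * x * a - 2000 * s * b\<bar> \<le> 9 * 2000 * b) \<and>
     (case horner (x * x) (10 ^ 6) 0 10 of (a, b) \<Rightarrow>
        10 * \<bar>10 ^ 8 * a - 2 * k * b\<bar> \<le> 9 * 2 * b)"

lemma trig_ok_sound:
  assumes "trig_ok x s k"
  defines "\<xi> \<equiv> real_of_int x / 10 ^ 3"
  shows "\<bar>10 ^ 8 * (sin \<xi> / 2) - s\<bar> \<le> 1" and "\<bar>10 ^ 8 * (cos \<xi> / 2) - k\<bar> \<le> 1"
proof -
  have x: "\<bar>\<xi>\<bar> \<le> 32 / 10"
    using assms(1) by (simp add: trig_ok_def \<xi>_def field_simps flip: of_int_abs)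
  obtain a b where h: "horner (x * x) (10 ^ 6) (int 1) 10 = (a, b)" by fastforce
  note H = horner_eq_sum[OF _ h, simplified]
  have le: "10 * \<bar>10 ^ 8 * x * a - 2000 * s * b\<bar> \<le> 9 * 2000 * b"
    using assms(1) h by (simp add: trig_ok_def)
  have b: "b > 0" using H by simp
  have eq: "(\<Sum>m<23. sin_coeff m * \<xi> ^ m) = \<xi> * (real_of_int a / real_of_int b)"
    using sin_partial_sum[of \<xi> 10] H by (simp add: \<xi>_def)
  have e1: "\<bar>sin \<xi> - \<xi> * (real_of_int a / real_of_int b)\<bar> \<le> 1 / 10 ^ 9"
  proof -
    have "\<bar>sin \<xi> - \<xi> * (real_of_int a / real_of_int b)\<bar> \<le> inverse (fact 23) * \<bar>\<xi>\<bar> ^ 23"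
      using Maclaurin_sin_bound[of \<xi> 23] eq by simp
    also have "\<dots> \<le> inverse (fact 23) * (32 / 10) ^ 23"
      by (intro mult_left_mono power_mono x) auto
    also have "\<dots> \<le> 1 / 10 ^ 9" by (simp add: fact_numeral field_simps)
    finally show ?thesis .
  qed
  have "10 * \<bar>10 ^ 8 * real_of_int x * a - 2000 * s * b\<bar> \<le> 9 * 2000 * real_of_int b"
    using le unfolding of_int_le_iff[symmetric, where 'a = real] by simp
  also have "10 ^ 8 * real_of_int x * a - 2000 * s * b =
      2000 * b * (10 ^ 8 * (\<xi> * (real_of_int a / real_of_int b) / 2) - s)"
    using b by (simp add: \<xi>_def field_simps)
  finally have "\<bar>10 ^ 8 * (\<xi> * (real_of_int a / real_of_int b) / 2) - s\<bar> \<le> 9 / 10"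
    using b by (simp add: abs_mult)
  moreover have "\<bar>10 ^ 8 * (u / 2) - s\<bar> \<le> 1"
    if "\<bar>u - w\<bar> \<le> 1 / 10 ^ 9" "\<bar>10 ^ 8 * (w / 2) - s\<bar> \<le> 9 / 10" for u w :: real
    using that unfolding abs_le_iff by (simp add: field_simps)
  ultimately show "\<bar>10 ^ 8 * (sin \<xi> / 2) - s\<bar> \<le> 1" using e1 by blast
next
  have x: "\<bar>\<xi>\<bar> \<le> 32 / 10"
    using assms(1) by (simp add: trig_ok_def \<xi>_def field_simps flip: of_int_abs)
  obtain a b where h: "horner (x * x) (10 ^ 6) (int 0) 10 = (a, b)" by fastforce
  note H = horner_eq_sum[OF _ h, simplified]
  have le: "10 * \<bar>10 ^ 8 * a - 2 * k * b\<bar> \<le> 9 * 2 * b"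
    using assms(1) h by (simp add: trig_ok_def)
  have b: "b > 0" using H by simp
  have eq: "(\<Sum>m<22. cos_coeff m * \<xi> ^ m) = real_of_int a / real_of_int b"
    using cos_partial_sum[of \<xi> 10] H by (simp add: \<xi>_def)
  have e1: "\<bar>cos \<xi> - real_of_int a / real_of_int b\<bar> \<le> 1 / 10 ^ 9"
  proof -
    obtain t where t: "cos \<xi> = real_of_int a / real_of_int b + cos (t + 1/2 * real 22 * pi) / fact 22 * \<xi> ^ 22"
      using Maclaurin_cos_expansion[of \<xi> 22] eq by auto
    have "\<bar>cos \<xi> - real_of_int a / real_of_int b\<bar> = inverse (fact 22) * (\<bar>cos (t + 1/2 * real 22 * pi)\<bar> * \<bar>\<xi>\<bar> ^ 22)"
      unfolding t by (simp add: abs_mult power_abs field_simps)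
    also have "\<dots> \<le> inverse (fact 22) * (1 * (32 / 10) ^ 22)"
      by (intro mult_left_mono mult_mono power_mono x) auto
    also have "\<dots> \<le> 1 / 10 ^ 9" by (simp add: fact_numeral field_simps)
    finally show ?thesis .
  qed
  have "10 * \<bar>10 ^ 8 * real_of_int a - 2 * k * b\<bar> \<le> 9 * 2 * real_of_int b"
    using le unfolding of_int_le_iff[symmetric, where 'a = real] by simp
  also have "10 ^ 8 * real_of_int a - 2 * k * b =
      2 * b * (10 ^ 8 * (real_of_int a / real_of_int b / 2) - k)"
    using b by (simp add: field_simps)
  finally have "\<bar>10 ^ 8 * (real_of_int a / real_of_int b / 2) - k\<bar> \<le> 9 / 10"
    using b by (simp add: abs_mult)
  moreover have "\<bar>10 ^ 8 * (u / 2) - k\<bar> \<le> 1"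
    if "\<bar>u - w\<bar> \<le> 1 / 10 ^ 9" "\<bar>10 ^ 8 * (w / 2) - k\<bar> \<le> 9 / 10" for u w :: real
    using that unfolding abs_le_iff by (simp add: field_simps)
  ultimately show "\<bar>10 ^ 8 * (cos \<xi> / 2) - k\<bar> \<le> 1" using e1 by blast
qed

section \<open>Curved tubes along orbits\<close>

definition lifted_map :: "real \<times> real \<Rightarrow> real \<times> real" where
  "lifted_map p = (fst p + (snd p + sin (fst p) / 2), snd p + sin (fst p) / 2)"

text \<open>
  \<open>Tube m x s k c e q g h \<rho>\<close> describes the points
  \<open>(x / 10 ^ 3, 0) + (c + e \<sigma> + q \<sigma>\<^sup>2 + g t + h r) / 10 ^ 8\<close> with \<open>\<sigma>, t, r \<in> {-1..1}\<close>. The coarse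
  base point \<open>x\<close> is the place where sine and cosine are evaluated, with values \<open>s\<close> and \<open>k\<close> as in
  \<open>trig_ok\<close>; the fine correction of the central point is part of \<open>c\<close>. The number \<open>m\<close> counts the full turns that are
  subtracted on arrival in the tube, and \<open>\<rho>\<close> bounds, in units of \<open>1 / 10 ^ 8\<close>, all errors that the next
  step commits in either coordinate.
\<close>

datatype tube = Tube (turn: int) (base: int) (half_sin: int) (half_cos: int)
  (centre: "int \<times> int") (tangent: "int \<times> int") (curvature: "int \<times> int")
  (side: "int \<times> int") (error_side: "int \<times> int") (tolerance: int)

fun tube_slice :: "tube \<Rightarrow> real \<Rightarrow> (real \<times> real) set" where
  "tube_slice (Tube m x s k (cX, cY) (eX, eY) (qX, qY) (gX, gY) (hX, hY) \<rho>) \<sigma> =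
     {p. \<exists>t r. \<bar>t\<bar> \<le> 1 \<and> \<bar>r\<bar> \<le> 1 \<and>
       10 ^ 8 * fst p = 10 ^ 5 * x + cX + eX * \<sigma> + qX * \<sigma>\<^sup>2 + gX * t + hX * r \<and>
       10 ^ 8 * snd p = cY + eY * \<sigma> + qY * \<sigma>\<^sup>2 + gY * t + hY * r}"

text \<open>
  Up to the factor \<open>10 ^ 8\<close>, the derivative of the map at a point where half the cosine of the first
  coordinate is \<open>k / 10 ^ 8\<close>.
\<close>

fun push_forward :: "int \<Rightarrow> int \<times> int \<Rightarrow> int \<times> int" where
  "push_forward k (a, b) = (10 ^ 8 * (a + b) + k * a, 10 ^ 8 * b + k * a)"

fun wedge :: "int \<times> int \<Rightarrow> int \<times> int \<Rightarrow> int" where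
  "wedge (a, b) (c, d) = a * d - b * c"

fun norm1 :: "int \<times> int \<Rightarrow> int" where
  "norm1 (a, b) = \<bar>a\<bar> + \<bar>b\<bar>"

fun near :: "int \<Rightarrow> int \<times> int \<Rightarrow> int \<times> int \<Rightarrow> bool" where
  "near d (a, b) (a', b') \<longleftrightarrow> \<bar>a - a'\<bar> \<le> d \<and> \<bar>b - b'\<bar> \<le> d"

text \<open>
  By Cramer's rule, these inequalities place the parallelogram spanned by \<open>a\<close> and \<open>b\<close>, enlarged by \<open>\<rho>\<close> in both
  coordinates and scaled down by \<open>10 ^ 8\<close>, inside the parallelogram spanned by \<open>g\<close> and \<open>h\<close>.
\<close>

definition frame_ok :: "int \<Rightarrow> int \<times> int \<Rightarrow> int \<times> int \<Rightarrow> int \<times> int \<Rightarrow> int \<times> int \<Rightarrow> bool" where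
  "frame_ok \<rho> a b g h \<longleftrightarrow> wedge g h \<noteq> 0 \<and>
     \<bar>wedge a h\<bar> + \<bar>wedge b h\<bar> + \<rho> * norm1 h \<le> 10 ^ 8 * \<bar>wedge g h\<bar> \<and>
     \<bar>wedge g a\<bar> + \<bar>wedge g b\<bar> + \<rho> * norm1 g \<le> 10 ^ 8 * \<bar>wedge g h\<bar>"

text \<open>
  The first summand bounds the part of the quadratic Taylor term that differs from its principal
  part \<open>e\<^sup>2 \<sigma>\<^sup>2\<close>, the second one the cubic remainder; \<open>z\<close> bounds the
  distance from the base point. The constant \<open>6\<close> reserves two units for the
  tabulated sine and cosine, three for rounding \<open>c\<close>, \<open>e\<close> and \<open>q\<close>, and one for the decimal
  approximation of \<open>2 \<pi>\<close>.
\<close>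

definition error_ok :: "int \<Rightarrow> int \<Rightarrow> int \<Rightarrow> int \<Rightarrow> bool" where
  "error_ok \<rho> s e z \<longleftrightarrow> z \<le> 10 ^ 7 \<and>
     6 * \<bar>s\<bar> * (z * z - e * e) + z * z * z \<le> 12 * 10 ^ 16 * (\<rho> - 6)"

text \<open>
  The new central curve is the image of the old one up to rounding, where the curvature receives
  the contribution \<open>- s e\<^sup>2 / 2\<close> of the second derivative of the sine; all that is
  neglected is absorbed by the new parallelogram. The constant \<open>628318531\<close> is \<open>2 \<pi>\<close> in units of \<open>1 / 10 ^ 8\<close>.
\<close>

fun step_ok :: "tube \<Rightarrow> tube \<Rightarrow> bool" where
  "step_ok (Tube m x s k (cX, cY) (eX, eY) (qX, qY) (gX, gY) (hX, hY) \<rho>)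
           (Tube m' x' s' k' (cX', cY') (eX', eY') (qX', qY') g' h' \<rho>') \<longleftrightarrow>
     (m' = 0 \<or> m' = 1) \<and> trig_ok x s k \<and>
     near (10 ^ 8) (push_forward k (cX, cY + s))
       (10 ^ 8 * (cX' + 10 ^ 5 * (x' - x) + 628318531 * m'), 10 ^ 8 * cY') \<and>
     near (10 ^ 8) (push_forward k (eX, eY)) (10 ^ 8 * eX', 10 ^ 8 * eY') \<and>
     near (2 * 10 ^ 16) (push_forward k (2 * 10 ^ 8 * qX, 2 * 10 ^ 8 * qY))
       (2 * 10 ^ 16 * qX' + s * (eX * eX), 2 * 10 ^ 16 * qY' + s * (eX * eX)) \<and>
     error_ok \<rho> s eX (\<bar>cX\<bar> + \<bar>eX\<bar> + \<bar>qX\<bar> + \<bar>gX\<bar> + \<bar>hX\<bar>) \<and>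
     frame_ok (10 ^ 8 * \<rho>) (push_forward k (gX, gY)) (push_forward k (hX, hY)) g' h'"

lemma coordinates_in_frame:
  fixes g1 g2 h1 h2 :: real
  defines "D \<equiv> g1 * h2 - g2 * h1"
  assumes "D \<noteq> 0" "K > 0"
    and gt: "\<bar>a1 * h2 - a2 * h1\<bar> + \<bar>b1 * h2 - b2 * h1\<bar> + \<rho> * (\<bar>h1\<bar> + \<bar>h2\<bar>) \<le> K * \<bar>D\<bar>"
    and hr: "\<bar>g1 * a2 - g2 * a1\<bar> + \<bar>g1 * b2 - g2 * b1\<bar> + \<rho> * (\<bar>g1\<bar> + \<bar>g2\<bar>) \<le> K * \<bar>D\<bar>"
    and tr: "\<bar>t\<bar> \<le> 1" "\<bar>r\<bar> \<le> 1" and uv: "\<bar>u\<bar> \<le> \<rho>" "\<bar>v\<bar> \<le> \<rho>"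
  shows "\<exists>t' r'. \<bar>t'\<bar> \<le> 1 \<and> \<bar>r'\<bar> \<le> 1 \<and>
    K * (g1 * t' + h1 * r') = a1 * t + b1 * r + u \<and>
    K * (g2 * t' + h2 * r') = a2 * t + b2 * r + v"
proof -
  define w1 w2 where "w1 = a1 * t + b1 * r + u" and "w2 = a2 * t + b2 * r + v"
  have scale: "\<bar>c * \<tau>\<bar> \<le> \<bar>c\<bar> * B" if "\<bar>\<tau>\<bar> \<le> B" for c \<tau> B :: real
    using that by (simp add: abs_mult mult_left_mono)
  have triangle: "\<bar>a + b + c + d\<bar> \<le> S"
    if "\<bar>a\<bar> \<le> a'" "\<bar>b\<bar> \<le> b'" "\<bar>c\<bar> \<le> c'" "\<bar>d\<bar> \<le> d'" "a' + b' + c' + d' \<le> S"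
    for a b c d a' b' c' d' S :: real
    using that by linarith
  have "w1 * h2 - w2 * h1 =
      (a1 * h2 - a2 * h1) * t + (b1 * h2 - b2 * h1) * r + h2 * u + (- h1) * v"
    unfolding w1_def w2_def by (simp add: algebra_simps)
  also have "\<bar>\<dots>\<bar> \<le> K * \<bar>D\<bar>"
    by (rule triangle[OF scale[OF tr(1)] scale[OF tr(2)] scale[OF uv(1)] scale[OF uv(2)]])
      (use gt in \<open>simp add: algebra_simps\<close>)
  finally have 1: "\<bar>(w1 * h2 - w2 * h1) / (K * D)\<bar> \<le> 1"
    using \<open>D \<noteq> 0\<close> \<open>K > 0\<close> by (simp add: abs_mult divide_simps)
  have "g1 * w2 - g2 * w1 =
      (g1 * a2 - g2 * a1) * t + (g1 * b2 - g2 * b1) * r + g1 * v + (- g2) * u"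
    unfolding w1_def w2_def by (simp add: algebra_simps)
  also have "\<bar>\<dots>\<bar> \<le> K * \<bar>D\<bar>"
    by (rule triangle[OF scale[OF tr(1)] scale[OF tr(2)] scale[OF uv(2)] scale[OF uv(1)]])
      (use hr in \<open>simp add: algebra_simps\<close>)
  finally have 2: "\<bar>(g1 * w2 - g2 * w1) / (K * D)\<bar> \<le> 1"
    using \<open>D \<noteq> 0\<close> \<open>K > 0\<close> by (simp add: abs_mult divide_simps)
  have cancel: "K * (a * (M / (K * D)) + b * (N / (K * D))) = (a * M + b * N) / D" for a b M N
    using \<open>K > 0\<close> by (simp add: distrib_left add_divide_distrib)
  have "g1 * (w1 * h2 - w2 * h1) + h1 * (g1 * w2 - g2 * w1) = w1 * D"
    "g2 * (w1 * h2 - w2 * h1) + h2 * (g1 * w2 - g2 * w1) = w2 * D"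
    by (simp_all add: D_def algebra_simps)
  then have "K * (g1 * ((w1 * h2 - w2 * h1) / (K * D)) + h1 * ((g1 * w2 - g2 * w1) / (K * D))) = w1"
    "K * (g2 * ((w1 * h2 - w2 * h1) / (K * D)) + h2 * ((g1 * w2 - g2 * w1) / (K * D))) = w2"
    unfolding cancel using \<open>D \<noteq> 0\<close> by simp_all
  with 1 2 show ?thesis unfolding w1_def w2_def by blast
qed

text \<open>
  Here \<open>e\<close> stands for the dominant part of the displacement \<open>A\<close> from the base point, namely the tangential displacement
  along the central curve. Only its square enters the approximation, because it alone is
  too large for its square to be treated as an error.
\<close>

lemma half_sine_expansion:
  fixes s k A e :: real
  assumes s: "\<bar>10 ^ 8 * (sin x / 2) - s\<bar> \<le> 1" and k: "\<bar>10 ^ 8 * (cos x / 2) - k\<bar> \<le> 1"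
    and A: "\<bar>A - e\<bar> \<le> z - E" "\<bar>e\<bar> \<le> E" and z: "z \<le> 10 ^ 7"
    and err: "6 * \<bar>s\<bar> * (z * z - E * E) + z * z * z \<le> 12 * 10 ^ 16 * (\<rho> - 6)"
  shows "\<bar>10 ^ 8 * (sin (x + A / 10 ^ 8) / 2) - (s + k * A / 10 ^ 8 - s * (e * e) / (2 * 10 ^ 16))\<bar> \<le> \<rho> - 4"
proof -
  define \<xi> where "\<xi> = A / 10 ^ 8"
  define d1 d2 where "d1 = 10 ^ 8 * (sin x / 2) - s" and "d2 = 10 ^ 8 * (cos x / 2) - k"
  define R where "R = sin (x + \<xi>) - (sin x + \<xi> * cos x - \<xi>\<^sup>2 / 2 * sin x)"
  have Az: "\<bar>A\<bar> \<le> z" using A by linarith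
  then have \<xi>: "\<bar>\<xi>\<bar> \<le> 1 / 10" using z by (simp add: \<xi>_def)
  have "\<bar>R\<bar> \<le> \<bar>\<xi>\<bar> ^ 3 / 6" unfolding R_def by (rule sin_add_quadratic)
  also have "\<bar>\<xi>\<bar> ^ 3 \<le> (z / 10 ^ 8) ^ 3"
    using Az by (intro power_mono) (simp_all add: \<xi>_def divide_right_mono)
  finally have R: "\<bar>10 ^ 8 / 2 * R\<bar> \<le> z * z * z / (12 * 10 ^ 16)"
    by (simp add: power3_eq_cube abs_mult)
  have "\<bar>A * A - e * e\<bar> = \<bar>A - e\<bar> * \<bar>A + e\<bar>"
    by (simp add: abs_mult[symmetric] algebra_simps)
  also have "\<dots> \<le> (z - E) * (z + E)"
    using A Az by (intro mult_mono) auto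
  finally have "\<bar>s\<bar> * \<bar>A * A - e * e\<bar> \<le> \<bar>s\<bar> * (z * z - E * E)"
    by (intro mult_left_mono) (simp_all add: algebra_simps)
  then have Q: "\<bar>s * (A * A - e * e) / (2 * 10 ^ 16)\<bar> \<le> 6 * \<bar>s\<bar> * (z * z - E * E) / (12 * 10 ^ 16)"
    by (simp add: abs_mult)
  have "\<xi>\<^sup>2 \<le> (1 / 10)\<^sup>2" using \<xi> by (simp add: abs_le_square_iff[symmetric])
  then have "\<bar>1 - \<xi>\<^sup>2 / 2\<bar> \<le> 1" by (simp add: abs_le_iff power2_eq_square)
  then have d1: "\<bar>d1 * (1 - \<xi>\<^sup>2 / 2)\<bar> \<le> 1"
    using s mult_mono[of "\<bar>d1\<bar>" 1 "\<bar>1 - \<xi>\<^sup>2 / 2\<bar>" 1] by (simp add: d1_def abs_mult)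
  have d2: "\<bar>d2 * \<xi>\<bar> \<le> 1"
    using k \<xi> mult_mono[of "\<bar>d2\<bar>" 1 "\<bar>\<xi>\<bar>" 1] by (simp add: d2_def abs_mult)
  have "10 ^ 8 * (sin (x + \<xi>) / 2) - (s + k * A / 10 ^ 8 - s * (e * e) / (2 * 10 ^ 16)) =
     d1 * (1 - \<xi>\<^sup>2 / 2) + d2 * \<xi> + 10 ^ 8 / 2 * R - s * (A * A - e * e) / (2 * 10 ^ 16)"
    unfolding d1_def d2_def R_def \<xi>_def by (simp add: field_simps power2_eq_square)
  moreover have "6 * \<bar>s\<bar> * (z * z - E * E) / (12 * 10 ^ 16) + z * z * z / (12 * 10 ^ 16) \<le> \<rho> - 6"
  proof -
    have "P / M + Q / M \<le> c" if "P + Q \<le> M * c" "M > 0" for P Q M c :: real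
      using that by (simp add: add_divide_distrib[symmetric] pos_divide_le_eq mult.commute)
    from this[OF err] show ?thesis by simp
  qed
  moreover have "\<bar>a + b + c - d\<bar> \<le> \<rho> - 4"
    if "\<bar>a\<bar> \<le> 1" "\<bar>b\<bar> \<le> 1" "\<bar>c\<bar> \<le> C" "\<bar>d\<bar> \<le> D" "D + C \<le> \<rho> - 6" for a b c d C D
    using that by linarith
  ultimately show ?thesis using R Q d1 d2 unfolding \<xi>_def by metis
qed

text \<open>
  The slice parameter \<open>\<sigma>\<close> is the same on both sides. Thus the ends of the initial strip can be followed
  to the ends of the last tube, and yet the whole strip is enclosed at once.
\<close>

lemma step_ok_sound:
  assumes "step_ok T T'" "\<bar>\<sigma>\<bar> \<le> 1" "p \<in> tube_slice T \<sigma>"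
  shows "lifted_map p - (2 * pi * turn T', 0) \<in> tube_slice T' \<sigma>"
proof -
  obtain m x s k cX cY eX eY qX qY gX gY hX hY \<rho> where
    T: "T = Tube m x s k (cX, cY) (eX, eY) (qX, qY) (gX, gY) (hX, hY) \<rho>"
    by (metis tube.exhaust surj_pair)
  obtain m' x' s' k' cX' cY' eX' eY' qX' qY' gX' gY' hX' hY' \<rho>' where
    T': "T' = Tube m' x' s' k' (cX', cY') (eX', eY') (qX', qY') (gX', gY') (hX', hY') \<rho>'"
    by (metis tube.exhaust surj_pair)
  obtain X Y where p: "p = (X, Y)" by fastforce
  obtain t r :: real where tr: "\<bar>t\<bar> \<le> 1" "\<bar>r\<bar> \<le> 1"
    and X: "10 ^ 8 * X = 10 ^ 5 * x + cX + eX * \<sigma> + qX * \<sigma>\<^sup>2 + gX * t + hX * r"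
    and Y: "10 ^ 8 * Y = cY + eY * \<sigma> + qY * \<sigma>\<^sup>2 + gY * t + hY * r"
    using assms(3) unfolding T p by auto
  note ok = assms(1)[unfolded T T' step_ok.simps push_forward.simps near.simps]
  define A where "A = cX + eX * \<sigma> + qX * \<sigma>\<^sup>2 + gX * t + hX * r"
  define z where "z = \<bar>cX\<bar> + \<bar>eX\<bar> + \<bar>qX\<bar> + \<bar>gX\<bar> + \<bar>hX\<bar>"
  have "10 ^ 8 * X = 10 ^ 5 * x + A" using X by (simp add: A_def)
  then have XA: "X = x / 10 ^ 3 + A / 10 ^ 8" by simp
  have \<sigma>2: "\<bar>\<sigma>\<^sup>2\<bar> \<le> 1"
    using assms(2) by (simp add: power_le_one_iff abs_square_le_1)
  have scale: "\<bar>real_of_int c * \<tau>\<bar> \<le> \<bar>real_of_int c\<bar>" if "\<bar>\<tau>\<bar> \<le> 1" for c \<tau>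
    using that by (simp add: abs_mult mult_left_le)
  have trig: "\<bar>10 ^ 8 * (sin (x / 10 ^ 3) / 2) - s\<bar> \<le> 1" "\<bar>10 ^ 8 * (cos (x / 10 ^ 3) / 2) - k\<bar> \<le> 1"
    using trig_ok_sound ok by blast+
  define \<epsilon> where "\<epsilon> = 10 ^ 8 * (sin X / 2) - (s + k * A / 10 ^ 8 - s * ((eX * \<sigma>) * (eX * \<sigma>)) / (2 * 10 ^ 16))"
  have \<epsilon>: "\<bar>\<epsilon>\<bar> \<le> real_of_int \<rho> - 4"
    unfolding \<epsilon>_def XA
  proof (rule half_sine_expansion[OF trig])
    show "\<bar>A - eX * \<sigma>\<bar> \<le> real_of_int z - \<bar>real_of_int eX\<bar>"
      using scale[OF \<sigma>2, of qX] scale[OF tr(1), of gX] scale[OF tr(2), of hX]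
      unfolding A_def z_def by (simp, linarith)
    show "\<bar>eX * \<sigma>\<bar> \<le> \<bar>real_of_int eX\<bar>" by (rule scale[OF assms(2)])
    have e: "error_ok \<rho> s eX z" using ok by (simp add: z_def)
    then have "real_of_int z \<le> real_of_int (10 ^ 7)"
      "real_of_int (6 * \<bar>s\<bar> * (z * z - eX * eX) + z * z * z) \<le> real_of_int (12 * 10 ^ 16 * (\<rho> - 6))"
      unfolding error_ok_def of_int_le_iff by auto
    then show "real_of_int z \<le> 10 ^ 7"
      "6 * \<bar>real_of_int s\<bar> * (real_of_int z * real_of_int z - \<bar>real_of_int eX\<bar> * \<bar>real_of_int eX\<bar>) +
        real_of_int z * real_of_int z * real_of_int z \<le> 12 * 10 ^ 16 * (real_of_int \<rho> - 6)"
      by simp_all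
  qed
  have bound: "\<bar>real_of_int a / real_of_int d\<bar> \<le> 1" if "\<bar>a\<bar> \<le> d" "d > 0" for a d
  proof -
    have "\<bar>real_of_int a\<bar> \<le> real_of_int d" using that(1) by linarith
    then show ?thesis using that(2) by simp
  qed
  have c: "\<bar>cX + cY + s + k * cX / 10 ^ 8 - (cX' + 10 ^ 5 * (x' - x) + 628318531 * m')\<bar> \<le> 1"
      "\<bar>cY + s + k * cX / 10 ^ 8 - cY'\<bar> \<le> 1"
  proof -
    have "\<bar>real_of_int (10 ^ 8 * (cX + (cY + s)) + k * cX
        - 10 ^ 8 * (cX' + 10 ^ 5 * (x' - x) + 628318531 * m')) / real_of_int (10 ^ 8)\<bar> \<le> 1"
      "\<bar>real_of_int (10 ^ 8 * (cY + s) + k * cX - 10 ^ 8 * cY') / real_of_int (10 ^ 8)\<bar> \<le> 1"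
      by (rule bound; use ok in simp)+
    then show "\<bar>cX + cY + s + k * cX / 10 ^ 8 - (cX' + 10 ^ 5 * (x' - x) + 628318531 * m')\<bar> \<le> 1"
      "\<bar>cY + s + k * cX / 10 ^ 8 - cY'\<bar> \<le> 1"
      by (simp_all add: diff_divide_distrib add_divide_distrib algebra_simps)
  qed
  have e: "\<bar>eX + eY + k * eX / 10 ^ 8 - eX'\<bar> \<le> 1" "\<bar>eY + k * eX / 10 ^ 8 - eY'\<bar> \<le> 1"
  proof -
    have "\<bar>real_of_int (10 ^ 8 * (eX + eY) + k * eX - 10 ^ 8 * eX') / real_of_int (10 ^ 8)\<bar> \<le> 1"
      "\<bar>real_of_int (10 ^ 8 * eY + k * eX - 10 ^ 8 * eY') / real_of_int (10 ^ 8)\<bar> \<le> 1"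
      by (rule bound; use ok in simp)+
    then show "\<bar>eX + eY + k * eX / 10 ^ 8 - eX'\<bar> \<le> 1" "\<bar>eY + k * eX / 10 ^ 8 - eY'\<bar> \<le> 1"
      by (simp_all add: diff_divide_distrib add_divide_distrib)
  qed
  have q: "\<bar>qX + qY + k * qX / 10 ^ 8 - s * (eX * eX) / (2 * 10 ^ 16) - qX'\<bar> \<le> 1"
      "\<bar>qY + k * qX / 10 ^ 8 - s * (eX * eX) / (2 * 10 ^ 16) - qY'\<bar> \<le> 1"
  proof -
    have "\<bar>real_of_int (10 ^ 8 * (2 * 10 ^ 8 * qX + 2 * 10 ^ 8 * qY) + k * (2 * 10 ^ 8 * qX)
        - (2 * 10 ^ 16 * qX' + s * (eX * eX))) / real_of_int (2 * 10 ^ 16)\<bar> \<le> 1"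
      "\<bar>real_of_int (10 ^ 8 * (2 * 10 ^ 8 * qY) + k * (2 * 10 ^ 8 * qX)
        - (2 * 10 ^ 16 * qY' + s * (eX * eX))) / real_of_int (2 * 10 ^ 16)\<bar> \<le> 1"
      by (rule bound; use ok in simp)+
    then show "\<bar>qX + qY + k * qX / 10 ^ 8 - s * (eX * eX) / (2 * 10 ^ 16) - qX'\<bar> \<le> 1"
      "\<bar>qY + k * qX / 10 ^ 8 - s * (eX * eX) / (2 * 10 ^ 16) - qY'\<bar> \<le> 1"
      by (simp_all add: diff_divide_distrib add_divide_distrib algebra_simps)
  qed
  have turn: "\<bar>(628318531 - 2 * pi * 10 ^ 8) * m'\<bar> \<le> 1"
  proof -
    have "m' = 0 \<or> m' = 1" using ok by blast
    moreover have "\<bar>628318531 - 2 * pi * 10 ^ 8\<bar> \<le> 1"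
      using pi_approx by (simp add: abs_le_iff)
    ultimately show ?thesis by auto
  qed
  \<comment> \<open>What the image of \<open>p\<close> deviates from the new central curve, apart from the images of the
    two sides of the parallelogram.\<close>
  define u where "u = (cX + cY + s + k * cX / 10 ^ 8 - (cX' + 10 ^ 5 * (x' - x) + 628318531 * m'))
     + (eX + eY + k * eX / 10 ^ 8 - eX') * \<sigma>
     + (qX + qY + k * qX / 10 ^ 8 - s * (eX * eX) / (2 * 10 ^ 16) - qX') * \<sigma>\<^sup>2
     + (628318531 - 2 * pi * 10 ^ 8) * m' + \<epsilon>"
  define v where "v = (cY + s + k * cX / 10 ^ 8 - cY') + (eY + k * eX / 10 ^ 8 - eY') * \<sigma>
     + (qY + k * qX / 10 ^ 8 - s * (eX * eX) / (2 * 10 ^ 16) - qY') * \<sigma>\<^sup>2 + \<epsilon>"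
  have le1: "\<bar>a * \<tau>\<bar> \<le> 1" if "\<bar>a\<bar> \<le> 1" "\<bar>\<tau>\<bar> \<le> 1" for a \<tau> :: real
    using that mult_mono[of "\<bar>a\<bar>" 1 "\<bar>\<tau>\<bar>" 1] by (simp add: abs_mult)
  have u: "\<bar>10 ^ 8 * u\<bar> \<le> 10 ^ 8 * real_of_int \<rho>"
  proof -
    have "\<bar>10 ^ 8 * (a + b + c + d + \<epsilon>)\<bar> \<le> 10 ^ 8 * real_of_int \<rho>"
      if "\<bar>a\<bar> \<le> 1" "\<bar>b\<bar> \<le> 1" "\<bar>c\<bar> \<le> 1" "\<bar>d\<bar> \<le> 1" for a b c d
      using that \<epsilon> by simp
    then show ?thesis
      unfolding u_def using c(1) turn le1[OF e(1) assms(2)] le1[OF q(1) \<sigma>2] by blast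
  qed
  have v: "\<bar>10 ^ 8 * v\<bar> \<le> 10 ^ 8 * real_of_int \<rho>"
  proof -
    have "\<bar>10 ^ 8 * (a + b + c + \<epsilon>)\<bar> \<le> 10 ^ 8 * real_of_int \<rho>"
      if "\<bar>a\<bar> \<le> 1" "\<bar>b\<bar> \<le> 1" "\<bar>c\<bar> \<le> 1" for a b c
      using that \<epsilon> by simp
    then show ?thesis
      unfolding v_def using c(2) le1[OF e(2) assms(2)] le1[OF q(2) \<sigma>2] by blast
  qed
  have fr: "frame_ok (10 ^ 8 * \<rho>) (push_forward k (gX, gY)) (push_forward k (hX, hY)) (gX', gY') (hX', hY')"
    using ok by simp
  have D: "real_of_int gX' * real_of_int hY' - real_of_int gY' * real_of_int hX' \<noteq> 0"
  proof -
    have "gX' * hY' - gY' * hX' \<noteq> 0" using fr by (simp add: frame_ok_def)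
    then have "real_of_int (gX' * hY' - gY' * hX') \<noteq> 0" by (simp only: of_int_eq_0_iff not_False_eq_True)
    then show ?thesis by (simp only: of_int_diff of_int_mult not_False_eq_True)
  qed
  obtain t' r' :: real where t'r': "\<bar>t'\<bar> \<le> 1" "\<bar>r'\<bar> \<le> 1"
    "10 ^ 8 * (gX' * t' + hX' * r') = (10 ^ 8 * (gX + gY) + k * gX) * t + (10 ^ 8 * (hX + hY) + k * hX) * r + 10 ^ 8 * u"
    "10 ^ 8 * (gY' * t' + hY' * r') = (10 ^ 8 * gY + k * gX) * t + (10 ^ 8 * hY + k * hX) * r + 10 ^ 8 * v"
  proof -
    let ?a1 = "10 ^ 8 * (gX + gY) + k * gX" and ?a2 = "10 ^ 8 * gY + k * gX"
      and ?b1 = "10 ^ 8 * (hX + hY) + k * hX" and ?b2 = "10 ^ 8 * hY + k * hX"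
    let ?D = "gX' * hY' - gY' * hX'"
    have "\<bar>?a1 * hY' - ?a2 * hX'\<bar> + \<bar>?b1 * hY' - ?b2 * hX'\<bar> + 10 ^ 8 * \<rho> * (\<bar>hX'\<bar> + \<bar>hY'\<bar>) \<le> 10 ^ 8 * \<bar>?D\<bar>"
      "\<bar>gX' * ?a2 - gY' * ?a1\<bar> + \<bar>gX' * ?b2 - gY' * ?b1\<bar> + 10 ^ 8 * \<rho> * (\<bar>gX'\<bar> + \<bar>gY'\<bar>) \<le> 10 ^ 8 * \<bar>?D\<bar>"
      using fr unfolding frame_ok_def by simp_all
    from this[THEN of_int_le_iff[where 'a = real, THEN iffD2]]
    have "\<bar>real_of_int ?a1 * hY' - real_of_int ?a2 * hX'\<bar> + \<bar>real_of_int ?b1 * hY' - real_of_int ?b2 * hX'\<bar>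
        + 10 ^ 8 * real_of_int \<rho> * (\<bar>real_of_int hX'\<bar> + \<bar>real_of_int hY'\<bar>)
        \<le> 10 ^ 8 * \<bar>real_of_int gX' * real_of_int hY' - real_of_int gY' * real_of_int hX'\<bar>"
      "\<bar>gX' * real_of_int ?a2 - gY' * real_of_int ?a1\<bar> + \<bar>gX' * real_of_int ?b2 - gY' * real_of_int ?b1\<bar>
        + 10 ^ 8 * real_of_int \<rho> * (\<bar>real_of_int gX'\<bar> + \<bar>real_of_int gY'\<bar>)
        \<le> 10 ^ 8 * \<bar>real_of_int gX' * real_of_int hY' - real_of_int gY' * real_of_int hX'\<bar>"
      by (simp_all only: of_int_add of_int_mult of_int_abs of_int_diff of_int_power of_int_numeral)
    from coordinates_in_frame[OF D _ this tr u v] that show thesis by auto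
  qed
  have S: "10 ^ 8 * (sin X / 2) = \<epsilon> + (s + k * A / 10 ^ 8 - s * ((eX * \<sigma>) * (eX * \<sigma>)) / (2 * 10 ^ 16))"
    by (simp add: \<epsilon>_def)
  have "10 ^ 8 * (Y + sin X / 2) = cY' + eY' * \<sigma> + qY' * \<sigma>\<^sup>2 + gY' * t' + hY' * r'"
    using t'r'(4) Y S unfolding v_def A_def
    by (simp add: algebra_simps add_divide_distrib power2_eq_square)
  moreover have "10 ^ 8 * (X + (Y + sin X / 2) - 2 * pi * m') =
      10 ^ 5 * x' + cX' + eX' * \<sigma> + qX' * \<sigma>\<^sup>2 + gX' * t' + hX' * r'"
    using t'r'(3) X Y S unfolding u_def A_def
    by (simp add: algebra_simps add_divide_distrib power2_eq_square)
  ultimately show ?thesis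
    unfolding T' p tube_slice.simps using t'r'(1,2)
    by - (rule CollectI, rule exI[of _ t'], rule exI[of _ r'], simp add: lifted_map_def)
qed

lemma lifted_map_translate: "lifted_map (p - (2 * pi * real_of_int k, 0)) = lifted_map p - (2 * pi * real_of_int k, 0)"
proof -
  have "sin (fst p - 2 * pi * real_of_int k) = sin (fst p)"
    by (simp add: sin_diff cos_int_2pin sin_int_2pin)
  then show ?thesis by (simp add: lifted_map_def prod_eq_iff)
qed

lemma lifted_map_funpow_translate: "(lifted_map ^^ n) (p - (2 * pi * real_of_int k, 0)) = (lifted_map ^^ n) p - (2 * pi * real_of_int k, 0)"
  by (induction n) (simp_all add: lifted_map_translate)

fun chain_ok :: "tube list \<Rightarrow> bool" where
  "chain_ok (T # T' # ts) \<longleftrightarrow> step_ok T T' \<and> chain_ok (T' # ts)"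
| "chain_ok ts \<longleftrightarrow> True"

lemma chain_ok_sound:
  assumes "chain_ok (T # ts)" "\<bar>\<sigma>\<bar> \<le> 1" "p \<in> tube_slice T \<sigma>"
  shows "(lifted_map ^^ length ts) p - (2 * pi * sum_list (map turn ts), 0) \<in> tube_slice (last (T # ts)) \<sigma>"
  using assms(1,3)
proof (induction ts arbitrary: T p)
  case Nil
  then show ?case by (simp flip: zero_prod_def)
next
  case (Cons T' ts)
  let ?q = "lifted_map p - (2 * pi * turn T', 0)"
  have "?q \<in> tube_slice T' \<sigma>"
    using Cons.prems assms(2) by (intro step_ok_sound[of T]) simp_all
  then have "(lifted_map ^^ length ts) ?q - (2 * pi * sum_list (map turn ts), 0) \<in> tube_slice (last (T' # ts)) \<sigma>"
    using Cons.prems by (intro Cons.IH) simp_all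
  moreover have "(lifted_map ^^ length ts) ?q - (2 * pi * sum_list (map turn ts), 0) =
      (lifted_map ^^ length (T' # ts)) p - (2 * pi * sum_list (map turn (T' # ts)), 0)"
    unfolding lifted_map_funpow_translate
    by (simp add: prod_eq_iff algebra_simps funpow_swap1)
  ultimately show ?case by simp
qed

section \<open>Return branches of a box at the saddle\<close>

definition ucoord :: "real \<times> real \<Rightarrow> real" where "ucoord p = fst p + snd p"
definition vcoord :: "real \<times> real \<Rightarrow> real" where "vcoord p = fst p - 2 * snd p"
definition saddle_box :: "(real \<times> real) set" where
  "saddle_box = {p. \<bar>ucoord p\<bar> \<le> 12 / 10 ^ 3 \<and> \<bar>vcoord p\<bar> \<le> 24 / 10 ^ 3}"

text \<open>
  The vertical strip of the box between \<open>lo\<close> and \<open>hi\<close> returns after \<open>n\<close> steps, having turned \<open>m\<close> times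
  around the circle: its two vertical sides land beyond opposite ends of the box, and in between the
  image never leaves through the top or the bottom. It may well leave the box beyond its ends, and
  the orientation is left open since the two homoclinic orbits cross in opposite directions.
\<close>

definition return_branch :: "nat \<Rightarrow> int \<Rightarrow> real \<Rightarrow> real \<Rightarrow> bool" where
  "return_branch n m lo hi \<longleftrightarrow> (let G = \<lambda>p. (lifted_map ^^ n) p - (2 * pi * m, 0) in
     (\<forall>p\<in>saddle_box. lo \<le> ucoord p \<and> ucoord p \<le> hi \<longrightarrow> \<bar>vcoord (G p)\<bar> \<le> 24 / 10 ^ 3) \<and>
     ((\<forall>p\<in>saddle_box. (ucoord p = lo \<longrightarrow> ucoord (G p) \<le> - 12 / 10 ^ 3) \<and> (ucoord p = hi \<longrightarrow> 12 / 10 ^ 3 \<le> ucoord (G p))) \<or>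
      (\<forall>p\<in>saddle_box. (ucoord p = lo \<longrightarrow> 12 / 10 ^ 3 \<le> ucoord (G p)) \<and> (ucoord p = hi \<longrightarrow> ucoord (G p) \<le> - 12 / 10 ^ 3))))"

text \<open>
  The slices of such a tube contain the vertical segments of the box: the parallelogram has the side
  \<open>(8, - 8) / 10 ^ 3\<close>, along which \<open>ucoord\<close> is constant and \<open>vcoord\<close> runs up to \<open>24 / 10 ^ 3\<close>, and along the central curve
  \<open>ucoord\<close> is \<open>3 (c + e \<sigma>) / 10 ^ 8\<close> while \<open>vcoord\<close> vanishes.
\<close>

fun entry_ok :: "int \<Rightarrow> int \<Rightarrow> tube \<Rightarrow> bool" where
  "entry_ok c e (Tube m x s k (cX, cY) (eX, eY) (qX, qY) (gX, gY) h \<rho>) \<longleftrightarrow>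
     10 ^ 5 * x + cX = 2 * c \<and> cY = c \<and> eX = 2 * e \<and> eY = e \<and> e > 0 \<and>
     qX = 0 \<and> qY = 0 \<and> gX = 800000 \<and> gY = - 800000"

fun exit_ok :: "tube \<Rightarrow> bool" where
  "exit_ok (Tube m x s k (cX, cY) (eX, eY) (qX, qY) (gX, gY) (hX, hY) \<rho>) \<longleftrightarrow>
     \<bar>10 ^ 5 * x + cX - 2 * cY\<bar> + \<bar>eX - 2 * eY\<bar> + \<bar>qX - 2 * qY\<bar> + \<bar>gX - 2 * gY\<bar> + \<bar>hX - 2 * hY\<bar> \<le> 2400000 \<and>
     1200000 + \<bar>10 ^ 5 * x + cX + cY + qX + qY\<bar> + \<bar>gX + gY\<bar> + \<bar>hX + hY\<bar> \<le> \<bar>eX + eY\<bar>"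

lemma entry_okD:
  assumes "entry_ok c e T" "p \<in> saddle_box" "3 * (c - e) / 10 ^ 8 \<le> ucoord p" "ucoord p \<le> 3 * (c + e) / 10 ^ 8"
  defines "\<sigma> \<equiv> (10 ^ 8 * ucoord p / 3 - c) / e"
  shows "\<bar>\<sigma>\<bar> \<le> 1" "p \<in> tube_slice T \<sigma>"
proof -
  obtain m x s k cX cY eX eY qX qY gX gY hX hY \<rho> where
    T: "T = Tube m x s k (cX, cY) (eX, eY) (qX, qY) (gX, gY) (hX, hY) \<rho>"
    by (metis tube.exhaust surj_pair)
  have ok: "real_of_int cX = 2 * c - 10 ^ 5 * x" "cY = c" "eX = 2 * e" "eY = e" "e > 0"
     "qX = 0" "qY = 0" "gX = 800000" "gY = - 800000"
    using assms(1) unfolding T by auto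
  have e\<sigma>: "e * \<sigma> = 10 ^ 8 * ucoord p / 3 - c"
    using ok(5) by (simp add: \<sigma>_def)
  have "\<bar>10 ^ 8 * ucoord p / 3 - c\<bar> \<le> e"
    using assms(3,4) by (simp add: abs_le_iff field_simps)
  then show "\<bar>\<sigma>\<bar> \<le> 1" using ok(5) by (simp add: \<sigma>_def)
  have "\<bar>vcoord p * 10 ^ 3 / 24\<bar> \<le> 1" using assms(2) by (simp add: saddle_box_def abs_mult)
  moreover have "10 ^ 8 * fst p = 10 ^ 5 * x + cX + eX * \<sigma> + qX * \<sigma>\<^sup>2 + gX * (vcoord p * 10 ^ 3 / 24) + hX * 0"
    "10 ^ 8 * snd p = cY + eY * \<sigma> + qY * \<sigma>\<^sup>2 + gY * (vcoord p * 10 ^ 3 / 24) + hY * 0"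
    using e\<sigma> by (simp_all add: ok ucoord_def vcoord_def field_simps)
  ultimately show "p \<in> tube_slice T \<sigma>"
    unfolding T tube_slice.simps
    by - (rule CollectI, rule exI[of _ "vcoord p * 10 ^ 3 / 24"], rule exI[of _ 0], simp)
qed

lemma exit_okD:
  assumes "exit_ok T" "\<bar>\<sigma>\<bar> \<le> 1" "p \<in> tube_slice T \<sigma>"
  shows "\<bar>vcoord p\<bar> \<le> 24 / 10 ^ 3"
proof -
  obtain m x s k cX cY eX eY qX qY gX gY hX hY \<rho> where
    T: "T = Tube m x s k (cX, cY) (eX, eY) (qX, qY) (gX, gY) (hX, hY) \<rho>"
    by (metis tube.exhaust surj_pair)
  obtain t r :: real where tr: "\<bar>t\<bar> \<le> 1" "\<bar>r\<bar> \<le> 1"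
    and p: "10 ^ 8 * fst p = 10 ^ 5 * x + cX + eX * \<sigma> + qX * \<sigma>\<^sup>2 + gX * t + hX * r"
      "10 ^ 8 * snd p = cY + eY * \<sigma> + qY * \<sigma>\<^sup>2 + gY * t + hY * r"
    using assms(3) unfolding T by auto
  have scale: "\<bar>real_of_int c * \<tau>\<bar> \<le> \<bar>real_of_int c\<bar>" if "\<bar>\<tau>\<bar> \<le> 1" for c \<tau>
    using that by (simp add: abs_mult mult_left_le)
  have \<sigma>2: "\<bar>\<sigma>\<^sup>2\<bar> \<le> 1" using assms(2) by (simp add: abs_square_le_1)
  have triangle: "\<bar>a + b + c + d + e\<bar> \<le> \<bar>a\<bar> + b' + c' + d' + e'"
    if "\<bar>b\<bar> \<le> b'" "\<bar>c\<bar> \<le> c'" "\<bar>d\<bar> \<le> d'" "\<bar>e\<bar> \<le> e'" for a b c d e b' c' d' e' :: real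
    using that by linarith
  have "10 ^ 8 * vcoord p = real_of_int (10 ^ 5 * x + cX - 2 * cY) + real_of_int (eX - 2 * eY) * \<sigma>
      + real_of_int (qX - 2 * qY) * \<sigma>\<^sup>2 + real_of_int (gX - 2 * gY) * t + real_of_int (hX - 2 * hY) * r"
    using p by (simp add: vcoord_def algebra_simps)
  also have "\<bar>\<dots>\<bar> \<le> \<bar>real_of_int (10 ^ 5 * x + cX - 2 * cY)\<bar> + \<bar>real_of_int (eX - 2 * eY)\<bar>
      + \<bar>real_of_int (qX - 2 * qY)\<bar> + \<bar>real_of_int (gX - 2 * gY)\<bar> + \<bar>real_of_int (hX - 2 * hY)\<bar>"
    by (rule triangle[OF scale[OF assms(2)] scale[OF \<sigma>2] scale[OF tr(1)] scale[OF tr(2)]])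
  also have "\<dots> \<le> 2400000"
  proof -
    have "\<bar>10 ^ 5 * x + cX - 2 * cY\<bar> + \<bar>eX - 2 * eY\<bar> + \<bar>qX - 2 * qY\<bar> + \<bar>gX - 2 * gY\<bar> + \<bar>hX - 2 * hY\<bar> \<le> 2400000"
      using assms(1) unfolding T by simp
    from this[THEN of_int_le_iff[where 'a = real, THEN iffD2]] show ?thesis by simp
  qed
  finally show ?thesis by (simp add: abs_mult)
qed

text \<open>
  Which end of the tube leaves on which side is decided by the sign of the expanding component of its tangent.
\<close>

lemma exit_ok_crosses:
  assumes "exit_ok T"
  shows "(\<forall>p. (p \<in> tube_slice T (- 1) \<longrightarrow> ucoord p \<le> - 12 / 10 ^ 3) \<and> (p \<in> tube_slice T 1 \<longrightarrow> 12 / 10 ^ 3 \<le> ucoord p)) \<or>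
    (\<forall>p. (p \<in> tube_slice T (- 1) \<longrightarrow> 12 / 10 ^ 3 \<le> ucoord p) \<and> (p \<in> tube_slice T 1 \<longrightarrow> ucoord p \<le> - 12 / 10 ^ 3))"
proof -
  obtain m x s k cX cY eX eY qX qY gX gY hX hY \<rho> where
    T: "T = Tube m x s k (cX, cY) (eX, eY) (qX, qY) (gX, gY) (hX, hY) \<rho>"
    by (metis tube.exhaust surj_pair)
  define E where "E = real_of_int (eX + eY)"
  define M where "M = \<bar>real_of_int (10 ^ 5 * x + cX + cY + qX + qY)\<bar> + \<bar>real_of_int (gX + gY)\<bar> + \<bar>real_of_int (hX + hY)\<bar>"
  have scale: "\<bar>real_of_int c * \<tau>\<bar> \<le> \<bar>real_of_int c\<bar>" if "\<bar>\<tau>\<bar> \<le> 1" for c \<tau>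
    using that by (simp add: abs_mult mult_left_le)
  have near: "\<bar>10 ^ 8 * ucoord p - E * \<sigma>\<bar> \<le> M" if p_in: "p \<in> tube_slice T \<sigma>" and sq: "\<sigma>\<^sup>2 = 1" for p \<sigma>
  proof -
    obtain t r :: real where tr: "\<bar>t\<bar> \<le> 1" "\<bar>r\<bar> \<le> 1"
      and p: "10 ^ 8 * fst p = 10 ^ 5 * x + cX + eX * \<sigma> + qX * \<sigma>\<^sup>2 + gX * t + hX * r"
        "10 ^ 8 * snd p = cY + eY * \<sigma> + qY * \<sigma>\<^sup>2 + gY * t + hY * r"
      using p_in unfolding T by auto
    have "10 ^ 8 * ucoord p - E * \<sigma> = real_of_int (10 ^ 5 * x + cX + cY + qX + qY)
        + real_of_int (gX + gY) * t + real_of_int (hX + hY) * r"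
      using p sq by (simp add: ucoord_def E_def algebra_simps)
    also have "\<bar>\<dots>\<bar> \<le> M"
    proof -
      have "\<bar>a + b + c\<bar> \<le> \<bar>a\<bar> + b' + c'" if "\<bar>b\<bar> \<le> b'" "\<bar>c\<bar> \<le> c'" for a b c b' c' :: real
        using that by linarith
      then show ?thesis unfolding M_def using scale[OF tr(1)] scale[OF tr(2)] by blast
    qed
    finally show ?thesis .
  qed
  have E: "1200000 + M \<le> \<bar>E\<bar>"
  proof -
    have "1200000 + (\<bar>10 ^ 5 * x + cX + cY + qX + qY\<bar> + \<bar>gX + gY\<bar> + \<bar>hX + hY\<bar>) \<le> \<bar>eX + eY\<bar>"
      using assms unfolding T by simp
    from this[THEN of_int_le_iff[where 'a = real, THEN iffD2]] show ?thesis
      by (simp add: E_def M_def)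
  qed
  have left: "\<bar>10 ^ 8 * ucoord p + E\<bar> \<le> M" if "p \<in> tube_slice T (- 1)" for p
    using near[OF that] by simp
  have right: "\<bar>10 ^ 8 * ucoord p - E\<bar> \<le> M" if "p \<in> tube_slice T 1" for p
    using near[OF that] by simp
  show ?thesis
  proof (cases "E \<ge> 0")
    case True
    have "ucoord p \<le> - 12 / 10 ^ 3" if "p \<in> tube_slice T (- 1)" for p using left[OF that] E True by simp
    moreover have "12 / 10 ^ 3 \<le> ucoord p" if "p \<in> tube_slice T 1" for p using right[OF that] E True by simp
    ultimately show ?thesis by blast
  next
    case False
    have "12 / 10 ^ 3 \<le> ucoord p" if "p \<in> tube_slice T (- 1)" for p using left[OF that] E False by simp
    moreover have "ucoord p \<le> - 12 / 10 ^ 3" if "p \<in> tube_slice T 1" for p using right[OF that] E False by simp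
    ultimately show ?thesis by blast
  qed
qed

lemma return_branch_if_chain_ok:
  assumes "entry_ok c e T" "chain_ok (T # ts)" "exit_ok (last (T # ts))" "sum_list (map turn ts) = m"
  shows "return_branch (length ts) m
    (3 * (real_of_int c - real_of_int e) / 10 ^ 8) (3 * (real_of_int c + real_of_int e) / 10 ^ 8)"
proof -
  let ?lo = "3 * (real_of_int c - real_of_int e) / 10 ^ 8"
    and ?hi = "3 * (real_of_int c + real_of_int e) / 10 ^ 8"
  let ?G = "\<lambda>p. (lifted_map ^^ length ts) p - (2 * pi * m, 0)"
  let ?L = "last (T # ts)"
  have e: "e > 0" using assms(1) by (cases "(c, e, T)" rule: entry_ok.cases) auto
  then have le: "?lo \<le> ?hi" by (simp add: field_simps)
  have G: "?G p \<in> tube_slice ?L ((10 ^ 8 * ucoord p / 3 - c) / e)"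
    if "p \<in> saddle_box" "?lo \<le> ucoord p" "ucoord p \<le> ?hi" for p
    using chain_ok_sound[OF assms(2) entry_okD[OF assms(1) that]] assms(4) by simp
  have ends: "(10 ^ 8 * ?lo / 3 - c) / e = - 1" "(10 ^ 8 * ?hi / 3 - c) / e = 1"
    using e by (simp_all add: field_simps)
  have lo: "?G p \<in> tube_slice ?L (- 1)" if "p \<in> saddle_box" "ucoord p = ?lo" for p
  proof -
    have "?lo \<le> ucoord p" "ucoord p \<le> ?hi" using that(2) le by (simp_all only: order_refl)
    from G[OF that(1) this] show ?thesis unfolding that(2) ends .
  qed
  have hi: "?G p \<in> tube_slice ?L 1" if "p \<in> saddle_box" "ucoord p = ?hi" for p
  proof -
    have "?lo \<le> ucoord p" "ucoord p \<le> ?hi" using that(2) le by (simp_all only: order_refl)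
    from G[OF that(1) this] show ?thesis unfolding that(2) ends .
  qed
  have "\<bar>vcoord (?G p)\<bar> \<le> 24 / 10 ^ 3" if "p \<in> saddle_box" "?lo \<le> ucoord p" "ucoord p \<le> ?hi" for p
    using exit_okD[OF assms(3) entry_okD(1)[OF assms(1) that] G[OF that]] .
  moreover have "(\<forall>p\<in>saddle_box. (ucoord p = ?lo \<longrightarrow> ucoord (?G p) \<le> - 12 / 10 ^ 3) \<and> (ucoord p = ?hi \<longrightarrow> 12 / 10 ^ 3 \<le> ucoord (?G p))) \<or>
      (\<forall>p\<in>saddle_box. (ucoord p = ?lo \<longrightarrow> 12 / 10 ^ 3 \<le> ucoord (?G p)) \<and> (ucoord p = ?hi \<longrightarrow> ucoord (?G p) \<le> - 12 / 10 ^ 3))"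
    using exit_ok_crosses[OF assms(3)]
  proof (elim disjE)
    assume *: "\<forall>p. (p \<in> tube_slice ?L (- 1) \<longrightarrow> ucoord p \<le> - 12 / 10 ^ 3) \<and> (p \<in> tube_slice ?L 1 \<longrightarrow> 12 / 10 ^ 3 \<le> ucoord p)"
    show ?thesis by (intro disjI1 ballI conjI impI; use * lo hi in \<open>simp only:\<close>)
  next
    assume *: "\<forall>p. (p \<in> tube_slice ?L (- 1) \<longrightarrow> 12 / 10 ^ 3 \<le> ucoord p) \<and> (p \<in> tube_slice ?L 1 \<longrightarrow> ucoord p \<le> - 12 / 10 ^ 3)"
    show ?thesis by (intro disjI2 ballI conjI impI; use * lo hi in \<open>simp only:\<close>)
  qed
  ultimately show ?thesis unfolding return_branch_def Let_def by (intro conjI ballI impI) simp_all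
qed

lemma ucoord_uminus [simp]: "ucoord (- p) = - ucoord p" and vcoord_uminus [simp]: "vcoord (- p) = - vcoord p"
  by (simp_all add: ucoord_def vcoord_def)

lemma saddle_box_uminus [simp]: "- p \<in> saddle_box \<longleftrightarrow> p \<in> saddle_box"
  by (simp add: saddle_box_def)

lemma lifted_map_funpow_uminus: "(lifted_map ^^ n) (- p) = - (lifted_map ^^ n) p"
  by (induction n) (simp_all add: lifted_map_def prod_eq_iff)

text \<open>
  The map commutes with the point reflection at the saddle, which turns an excursion to the right into one to
  the left.
\<close>

lemma return_branch_uminus:
  assumes "return_branch n m lo hi"
  shows "return_branch n (- m) (- hi) (- lo)"
proof -
  have G: "(lifted_map ^^ n) p - (2 * pi * real_of_int (- m), 0) = - ((lifted_map ^^ n) (- p) - (2 * pi * real_of_int m, 0))" for p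
    unfolding lifted_map_funpow_uminus by (simp add: prod_eq_iff)
  have box: "(\<forall>p\<in>saddle_box. P p) \<longleftrightarrow> (\<forall>p\<in>saddle_box. P (- p))" for P
    by (metis saddle_box_uminus add.inverse_inverse)
  have *: "(- a \<le> - 12 / 10 ^ 3 \<longleftrightarrow> 12 / 10 ^ 3 \<le> a)" "(12 / 10 ^ 3 \<le> - a \<longleftrightarrow> a \<le> - 12 / 10 ^ 3)" for a :: real
    by auto
  show ?thesis
    using assms unfolding return_branch_def Let_def G
    by (subst (1 2 3) box)
      (simp only: ucoord_uminus vcoord_uminus minus_minus neg_le_iff_le neg_equal_iff_equal abs_minus_cancel *, blast)
qed

lemma abs_sin_minus_le: "\<bar>sin x - x\<bar> \<le> 2 / 10 ^ 6" if "\<bar>x\<bar> \<le> 2 / 10 ^ 2" for x :: real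
proof -
  have "\<bar>sin x - x\<bar> \<le> \<bar>x\<bar> ^ 3 / 6" using sin_add_quadratic[of 0 x] by simp
  also have "\<dots> \<le> (2 / 10 ^ 2) ^ 3 / 6" using that by (intro divide_right_mono power_mono) auto
  finally show ?thesis by (simp add: power3_eq_cube)
qed

text \<open>
  One step doubles \<open>ucoord\<close> and halves \<open>vcoord\<close> up to an error of order \<open>sin X - X\<close>, so a strip slightly more
  than half as wide as the box is mapped across it.
\<close>

lemma return_branch_saddle: "return_branch 1 0 (- 62 / 10 ^ 4) (62 / 10 ^ 4)"
proof -
  have "\<bar>vcoord (lifted_map p)\<bar> \<le> 24 / 10 ^ 3 \<and> \<bar>ucoord (lifted_map p) - 2 * ucoord p\<bar> \<le> 2 / 10 ^ 6"
    if "p \<in> saddle_box" "\<bar>ucoord p\<bar> \<le> 62 / 10 ^ 4" for p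
  proof -
    have "fst p = (2 * ucoord p + vcoord p) / 3" by (simp add: ucoord_def vcoord_def)
    then have "\<bar>sin (fst p) - fst p\<bar> \<le> 2 / 10 ^ 6"
      using that by (intro abs_sin_minus_le) (simp add: saddle_box_def)
    moreover have "vcoord (lifted_map p) = vcoord p / 2 - (sin (fst p) - fst p) / 2" "ucoord (lifted_map p) - 2 * ucoord p = sin (fst p) - fst p"
      by (simp_all add: ucoord_def vcoord_def lifted_map_def field_simps)
    moreover have "\<bar>v / 2 - d / 2\<bar> \<le> 24 / 10 ^ 3"
      if "\<bar>v\<bar> \<le> 24 / 10 ^ 3" "\<bar>d\<bar> \<le> 2 / 10 ^ 6" for v d :: real
      using that unfolding abs_le_iff by (simp; linarith)
    ultimately show ?thesis using that(1) by (simp add: saddle_box_def)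
  qed
  note * = this
  have "ucoord (lifted_map p) \<le> - 12 / 10 ^ 3" if "p \<in> saddle_box" "ucoord p = - 62 / 10 ^ 4" for p
    using *[OF that(1)] unfolding that(2) abs_le_iff by simp
  moreover have "12 / 10 ^ 3 \<le> ucoord (lifted_map p)" if "p \<in> saddle_box" "ucoord p = 62 / 10 ^ 4" for p
    using *[OF that(1)] unfolding that(2) abs_le_iff by simp
  moreover have "\<bar>vcoord (lifted_map p)\<bar> \<le> 24 / 10 ^ 3" if "p \<in> saddle_box" "- 62 / 10 ^ 4 \<le> ucoord p" "ucoord p \<le> 62 / 10 ^ 4" for p
    using *[OF that(1)] that(2,3) by simp
  ultimately show ?thesis unfolding return_branch_def Let_def
    by (auto simp flip: zero_prod_def)
qed

section \<open>Realizing itineraries on crossing curves\<close>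

text \<open>
  The interval ends where \<open>g\<close> first reaches \<open>\<beta>\<close> and starts at the last passage through \<open>\<alpha>\<close> before
  that. The values at its ends are exact, and this is what allows the construction to be iterated.
\<close>

lemma increasing_crossing:
  fixes g :: "real \<Rightarrow> real"
  assumes g: "continuous_on {l..r} g" and "l \<le> r" "\<alpha> \<le> \<beta>" "g l \<le> \<alpha>" "\<beta> \<le> g r"
  obtains l' r' where "l \<le> l'" "l' \<le> r'" "r' \<le> r" "g l' = \<alpha>" "g r' = \<beta>"
    "\<And>x. l' \<le> x \<Longrightarrow> x \<le> r' \<Longrightarrow> \<alpha> \<le> g x \<and> g x \<le> \<beta>"
proof -
  let ?A = "{l..r} \<inter> g -` {\<beta>..}"
  have "compact ?A"
    by (metis bounded_Int bounded_closed_interval closed_atLeast closed_atLeastAtMost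
        compact_eq_bounded_closed continuous_closed_preimage g)
  moreover have "?A \<noteq> {}" using assms by auto
  ultimately obtain r' where r': "r' \<in> ?A" "\<And>x. x \<in> ?A \<Longrightarrow> r' \<le> x"
    using compact_attains_inf by meson
  have below: "g x < \<beta>" if "l \<le> x" "x < r'" for x
    using r'(2)[of x] r'(1) that by force
  have gr: "continuous_on {l..r'} g" by (rule continuous_on_subset[OF g]) (use r'(1) in auto)
  obtain y where "l \<le> y" "y \<le> r'" "g y = \<beta>"
    using IVT'[of g l \<beta> r'] assms r'(1) gr by auto
  then have r'\<beta>: "g r' = \<beta>" using below[of y] by (cases "y = r'") auto
  let ?B = "{l..r'} \<inter> g -` {..\<alpha>}"
  have "compact ?B"
    by (metis bounded_Int bounded_closed_interval closed_atMost closed_atLeastAtMost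
        compact_eq_bounded_closed continuous_closed_preimage gr)
  moreover have "?B \<noteq> {}" using assms r'(1) by auto
  ultimately obtain l' where l': "l' \<in> ?B" "\<And>x. x \<in> ?B \<Longrightarrow> x \<le> l'"
    using compact_attains_sup by meson
  have above: "\<alpha> < g x" if "l' < x" "x \<le> r'" for x
    using l'(2)[of x] l'(1) that by force
  have "continuous_on {l'..r'} g" by (rule continuous_on_subset[OF gr]) (use l'(1) in auto)
  then obtain y where "l' \<le> y" "y \<le> r'" "g y = \<alpha>"
    using IVT'[of g l' \<alpha> r'] assms l'(1) r'\<beta> by auto
  then have l'\<alpha>: "g l' = \<alpha>" using above[of y] by (cases "y = l'") auto
  show thesis
  proof
    show "l \<le> l'" "l' \<le> r'" "r' \<le> r" "g l' = \<alpha>" "g r' = \<beta>"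
      using l' r' l'\<alpha> r'\<beta> by auto
    show "\<alpha> \<le> g x \<and> g x \<le> \<beta>" if "l' \<le> x" "x \<le> r'" for x
      using below[of x] above[of x] l'\<alpha> r'\<beta> l'(1) that by (cases "x = l'"; cases "x = r'") auto
  qed
qed

lemma crossing:
  fixes g :: "real \<Rightarrow> real"
  assumes g: "continuous_on {l..r} g" and "l \<le> r" "\<alpha> \<le> \<beta>"
    and "g l \<le> \<alpha> \<and> \<beta> \<le> g r \<or> \<beta> \<le> g l \<and> g r \<le> \<alpha>"
  obtains l' r' where "l \<le> l'" "l' \<le> r'" "r' \<le> r"
    "g l' = \<alpha> \<and> g r' = \<beta> \<or> g l' = \<beta> \<and> g r' = \<alpha>"
    "\<And>x. l' \<le> x \<Longrightarrow> x \<le> r' \<Longrightarrow> \<alpha> \<le> g x \<and> g x \<le> \<beta>"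
  using assms(4)
proof
  assume "g l \<le> \<alpha> \<and> \<beta> \<le> g r"
  then show thesis
    using increasing_crossing[OF assms(1-3), of thesis] that by metis
next
  assume *: "\<beta> \<le> g l \<and> g r \<le> \<alpha>"
  obtain l' r' where "l \<le> l'" "l' \<le> r'" "r' \<le> r" "- g l' = - \<beta>" "- g r' = - \<alpha>"
    "\<And>x. l' \<le> x \<Longrightarrow> x \<le> r' \<Longrightarrow> - \<beta> \<le> - g x \<and> - g x \<le> - \<alpha>"
    using increasing_crossing[of l r "\<lambda>x. - g x" "- \<beta>" "- \<alpha>"] continuous_on_minus[OF g] assms(2,3) *
    by auto
  then show thesis using that[of l' r'] by force
qed

text \<open>
  A branch consists of return time, number of turns, and the two ends of its strip.
\<close>

type_synonym branch = "nat \<times> int \<times> real \<times> real"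

fun return_map :: "branch \<Rightarrow> real \<times> real \<Rightarrow> real \<times> real" where
  "return_map (n, m, lo, hi) p = (lifted_map ^^ n) p - (2 * pi * m, 0)"

fun strip :: "branch \<Rightarrow> (real \<times> real) set" where
  "strip (n, m, lo, hi) = {p \<in> saddle_box. lo \<le> ucoord p \<and> ucoord p \<le> hi}"

lemma continuous_on_ucoord: "continuous_on S \<gamma> \<Longrightarrow> continuous_on S (\<lambda>t. ucoord (\<gamma> t))"
  unfolding ucoord_def by (intro continuous_intros)

lemma continuous_on_return_map:
  fixes \<gamma> :: "real \<Rightarrow> real \<times> real"
  assumes "continuous_on S \<gamma>" shows "continuous_on S (\<lambda>t. return_map b (\<gamma> t))"
proof -
  have "continuous_on S (\<lambda>t. lifted_map (f t))" if "continuous_on S f" for f :: "real \<Rightarrow> real \<times> real"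
    unfolding lifted_map_def by (intro continuous_intros that) simp_all
  then have "continuous_on S (\<lambda>t. (lifted_map ^^ n) (\<gamma> t))" for n
    by (induction n) (simp_all add: assms)
  then show ?thesis by (cases b) (auto intro!: continuous_intros)
qed

text \<open>
  Induction on the word: cut the curve down to the strip of the first letter, map it, and cut it down
  again to a curve that joins the two ends of the box.
\<close>

lemma itinerary_on_crossing_curve:
  fixes \<gamma> :: "real \<Rightarrow> real \<times> real"
  assumes B: "\<And>n m lo hi. (n, m, lo, hi) \<in> B \<Longrightarrow> return_branch n m lo hi"
      "\<And>n m lo hi. (n, m, lo, hi) \<in> B \<Longrightarrow> - 12 / 10 ^ 3 \<le> lo \<and> lo \<le> hi \<and> hi \<le> 12 / 10 ^ 3"
    and "w \<in> lists B" "l \<le> r" "continuous_on {l..r} \<gamma>" "\<gamma> ` {l..r} \<subseteq> saddle_box"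
    and "ucoord (\<gamma> l) = - 12 / 10 ^ 3 \<and> ucoord (\<gamma> r) = 12 / 10 ^ 3 \<or> ucoord (\<gamma> l) = 12 / 10 ^ 3 \<and> ucoord (\<gamma> r) = - 12 / 10 ^ 3"
  shows "\<exists>t\<in>{l..r}. follows return_map strip (\<gamma> t) w"
  using assms(3-)
proof (induction w arbitrary: \<gamma> l r rule: list.induct)
  case Nil
  then show ?case by (intro bexI[of _ l]) simp_all
next
  case (Cons b w)
  obtain n m lo hi where b: "b = (n, m, lo, hi)" by (cases b)
  have bB: "(n, m, lo, hi) \<in> B" and w: "w \<in> lists B"
    using Cons.prems(1) by (simp_all add: b)
  let ?G = "return_map b"
  have branch: "\<And>p. p \<in> saddle_box \<Longrightarrow> lo \<le> ucoord p \<Longrightarrow> ucoord p \<le> hi \<Longrightarrow> \<bar>vcoord (?G p)\<bar> \<le> 24 / 10 ^ 3"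
    "(\<forall>p\<in>saddle_box. (ucoord p = lo \<longrightarrow> ucoord (?G p) \<le> - 12 / 10 ^ 3) \<and> (ucoord p = hi \<longrightarrow> 12 / 10 ^ 3 \<le> ucoord (?G p))) \<or>
     (\<forall>p\<in>saddle_box. (ucoord p = lo \<longrightarrow> 12 / 10 ^ 3 \<le> ucoord (?G p)) \<and> (ucoord p = hi \<longrightarrow> ucoord (?G p) \<le> - 12 / 10 ^ 3))"
    using B(1)[OF bB] unfolding return_branch_def Let_def b by simp_all
  obtain l' r' where lr': "l \<le> l'" "l' \<le> r'" "r' \<le> r"
    "ucoord (\<gamma> l') = lo \<and> ucoord (\<gamma> r') = hi \<or> ucoord (\<gamma> l') = hi \<and> ucoord (\<gamma> r') = lo"
    "\<And>x. l' \<le> x \<Longrightarrow> x \<le> r' \<Longrightarrow> lo \<le> ucoord (\<gamma> x) \<and> ucoord (\<gamma> x) \<le> hi"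
    by (rule crossing[OF continuous_on_ucoord[OF Cons.prems(3)] Cons.prems(2), of lo hi])
      (use B(2)[OF bB] Cons.prems(5) in auto)
  have box: "\<gamma> t \<in> saddle_box" if "l' \<le> t" "t \<le> r'" for t
    using Cons.prems(4) lr'(1,3) that by auto
  have cont: "continuous_on {l'..r'} (\<lambda>t. ?G (\<gamma> t))"
    by (intro continuous_on_return_map continuous_on_subset[OF Cons.prems(3)]) (use lr' in auto)
  have width: "- 12 / 10 ^ 3 \<le> (12 / 10 ^ 3 :: real)" by simp
  have ends: "ucoord (?G (\<gamma> l')) \<le> - 12 / 10 ^ 3 \<and> 12 / 10 ^ 3 \<le> ucoord (?G (\<gamma> r')) \<or>
      12 / 10 ^ 3 \<le> ucoord (?G (\<gamma> l')) \<and> ucoord (?G (\<gamma> r')) \<le> - 12 / 10 ^ 3"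
    using branch(2) box[of l'] box[of r'] lr'(2,4) by auto
  \<comment> \<open>The image overshoots both ends of the box and is cut off exactly there.\<close>
  obtain l'' r'' where lr'': "l' \<le> l''" "l'' \<le> r''" "r'' \<le> r'"
    "ucoord (?G (\<gamma> l'')) = - 12 / 10 ^ 3 \<and> ucoord (?G (\<gamma> r'')) = 12 / 10 ^ 3 \<or>
      ucoord (?G (\<gamma> l'')) = 12 / 10 ^ 3 \<and> ucoord (?G (\<gamma> r'')) = - 12 / 10 ^ 3"
    "\<And>x. l'' \<le> x \<Longrightarrow> x \<le> r'' \<Longrightarrow> - 12 / 10 ^ 3 \<le> ucoord (?G (\<gamma> x)) \<and> ucoord (?G (\<gamma> x)) \<le> 12 / 10 ^ 3"
    by (rule crossing[OF continuous_on_ucoord[OF cont] lr'(2) width ends], rule that, assumption+)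
  have "\<exists>t\<in>{l''..r''}. follows return_map strip (?G (\<gamma> t)) w"
  proof (rule Cons.IH[OF w lr''(2)])
    show "continuous_on {l''..r''} (\<lambda>t. ?G (\<gamma> t))"
      by (rule continuous_on_subset[OF cont]) (use lr'' in auto)
    show "(\<lambda>t. ?G (\<gamma> t)) ` {l''..r''} \<subseteq> saddle_box"
    proof (rule image_subsetI)
      fix t assume t: "t \<in> {l''..r''}"
      then have t': "l' \<le> t" "t \<le> r'" using lr'' by auto
      have "\<bar>ucoord (?G (\<gamma> t))\<bar> \<le> 12 / 10 ^ 3" using lr''(5)[of t] t unfolding abs_le_iff by (simp; linarith)
      moreover have "\<bar>vcoord (?G (\<gamma> t))\<bar> \<le> 24 / 10 ^ 3" using branch(1)[OF box[OF t']] lr'(5)[OF t'] by simp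
      ultimately show "?G (\<gamma> t) \<in> saddle_box" by (simp add: saddle_box_def)
    qed
  qed (rule lr''(4))
  then obtain t where t: "l'' \<le> t" "t \<le> r''" "follows return_map strip (?G (\<gamma> t)) w" by auto
  then have t': "l' \<le> t" "t \<le> r'" using lr'' by auto
  have "\<gamma> t \<in> strip b" using box[OF t'] lr'(5)[OF t'] by (simp add: b)
  moreover have "t \<in> {l..r}" using t' lr' by auto
  ultimately show ?case using t(3) by auto
qed

section \<open>Passage to the torus\<close>

definition torus_point :: "real \<times> real \<Rightarrow> torus" where
  "torus_point p = to_torus (fst p / (2 * pi), snd p / (2 * pi))"

lemma torus_point_lifted_map: "torus_point (lifted_map p) = standard_map (1/2) (torus_point p)"
  by (simp add: torus_point_def lifted_map_def standard_map_to_torus add_divide_distrib add.assoc mult.commute)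

lemma torus_point_return_map: "torus_point (return_map b p) = (standard_map (1/2) ^^ fst b) (torus_point p)"
proof -
  obtain n m lo hi where b: "b = (n, m, lo, hi)" by (cases b)
  have "torus_point ((lifted_map ^^ n) p) = (standard_map (1/2) ^^ n) (torus_point p)"
    by (induction n) (simp_all add: torus_point_lifted_map)
  moreover have "torus_point (q - (2 * pi * real_of_int m, 0)) = torus_point q" for q
    by (simp add: torus_point_def to_torus_eq_iff diff_divide_distrib)
  ultimately show ?thesis by (simp add: b)
qed

text \<open>
  The box is so small compared with the period that the distance on the torus is attained at lifts in the box
  itself; there it can be compared with \<open>ucoord\<close>.
\<close>

lemma dist_torus_point_ge:
  assumes p: "p \<in> saddle_box" and q: "q \<in> saddle_box" and g: "g > 0" "g \<le> \<bar>ucoord p - ucoord q\<bar>"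
  shows "dist (torus_point p) (torus_point q) > g / 30"
proof (rule ccontr)
  assume "\<not> ?thesis"
  then have "dist (torus_point p) (torus_point q) < g / 29" using g(1) by simp
  then obtain z where z: "to_torus z = torus_point q" "dist (fst p / (2 * pi), snd p / (2 * pi)) z < g / 29"
    unfolding torus_point_def[of p] by (rule dist_to_torus_less)
  have pi: "pi > 3" "pi < 4" using pi_approx by simp_all
  have XY: "\<bar>fst u / (2 * pi)\<bar> < 1 / 4 \<and> \<bar>snd u / (2 * pi)\<bar> < 1 / 4" if "u \<in> saddle_box" for u
  proof -
    have "fst u = (2 * ucoord u + vcoord u) / 3" "snd u = (ucoord u - vcoord u) / 3" by (simp_all add: ucoord_def vcoord_def)
    then have "\<bar>fst u\<bar> < 1" "\<bar>snd u\<bar> < 1"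
      using that unfolding saddle_box_def mem_Collect_eq abs_le_iff abs_less_iff by simp_all
    then show ?thesis using pi by (simp add: abs_mult divide_simps)
  qed
  have "\<bar>ucoord p\<bar> \<le> 12 / 10 ^ 3" "\<bar>ucoord q\<bar> \<le> 12 / 10 ^ 3" using p q by (auto simp: saddle_box_def)
  then have g': "g / 29 < 1 / 4" using g(2) by simp
  have d: "\<bar>fst p / (2 * pi) - fst z\<bar> < g / 29" "\<bar>snd p / (2 * pi) - snd z\<bar> < g / 29"
    using z(2) dist_fst_le[of "(fst p / (2 * pi), snd p / (2 * pi))" z]
      dist_snd_le[of "(fst p / (2 * pi), snd p / (2 * pi))" z] by (simp_all add: dist_real_def)
  have "fst z - fst q / (2 * pi) \<in> \<int>" "snd z - snd q / (2 * pi) \<in> \<int>"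
    using z(1) by (simp_all add: torus_point_def to_torus_eq_iff)
  moreover have "\<bar>fst z - fst q / (2 * pi)\<bar> < 1" "\<bar>snd z - snd q / (2 * pi)\<bar> < 1"
    using d XY[OF p] XY[OF q] g' by linarith+
  ultimately have "fst z = fst q / (2 * pi)" "snd z = snd q / (2 * pi)"
    using Ints_nonzero_abs_less1 by (metis eq_iff_diff_eq_0)+
  with d have small: "\<bar>fst p - fst q\<bar> / (2 * pi) < g / 29" "\<bar>snd p - snd q\<bar> / (2 * pi) < g / 29"
    by (simp_all add: abs_divide flip: diff_divide_distrib)
  have "a < 8 * g / 29" if "a / (2 * pi) < g / 29" for a
  proof -
    have "a < g / 29 * (2 * pi)" using that by (simp add: pos_divide_less_eq)
    also have "\<dots> \<le> g / 29 * 8" using g(1) pi by (intro mult_left_mono) auto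
    finally show ?thesis by simp
  qed
  with small have "\<bar>fst p - fst q\<bar> < 8 * g / 29" "\<bar>snd p - snd q\<bar> < 8 * g / 29" by blast+
  then show False using g unfolding ucoord_def by linarith
qed

section \<open>The two excursions along homoclinic orbits\<close>

text \<open>
  The central curves follow the unstable manifold of the saddle in both directions from a homoclinic
  orbit. The middle of the site orbit is the point with \<open>X = \<pi>\<close>; the change of sign in the base points marks the
  subtraction of a full turn. In the second half the side \<open>g\<close>, the image of the contracting direction, is stretched
  by the expansion at the saddle and makes up most of the final uncertainty of \<open>ucoord\<close>.
\<close>

definition site_tubes :: "tube list" where
  "site_tubes =
   [Tube 0 7 349997 49998775 (36600, 368300) (15000, 7500) (0, 0) (800000, -800000) (20, 10) 24,
    Tube 0 15 749972 49994375 (-26803, 736597) (30000, 15000) (0, 0) (402016, -402035) (74, 38) 15,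
    Tube 0 29 1449797 49978976 (46366, 1473169) (59998, 29998) (0, 0) (201988, -202072) (172, 87) 13,
    Tube 0 59 2948289 49913000 (-7495, 2946139) (119982, 59984) (0, 0) (101387, -101641) (366, 184) 12,
    Tube 0 118 5886318 49652304 (-16808, 5890687) (239853, 119871) (-2, -2) (50617, -51305) (754, 378) 18,
    Tube 0 236 11690769 48614051 (-48149, 11768659) (478817, 238964) (-22, -20) (24586, -26324) (1540, 769) 53,
    Tube 0 470 22644314 44578414 (-12128, 23436021) (950553, 471736) (-187, -165) (10309, -14504) (3142, 1560) 70,
    Tube 0 931 40110869 29851603 (-37199, 46074929) (1846030, 895477) (-1458, -1271) (408, -10062) (6206, 3011) 402,
    Tube 0 1792 48781703 (-10970206) (37495, 86174694) (3292577, 1446547) (-9999, -8541) (-10546, -10997) (12494, 5490) 1469,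
    Tube 0 3142 (-20367) (-49999996) (-10221, 134952284) (4377922, 1085345) (-43885, -33886) (-28340, -13680) (26019, 6451) 760,
    Tube 1 (-1792) (-48781703) (-10970206) (8275, 134937027) (3274306, -1103616) (-55809, -11924) (-31190, 550) (21990, -7413) 2238,
    Tube 0 (-930) (-40080997) 29891699 (-37309, 86154416) (1811492, -1462814) (-35461, 20348) (-33504, 4890) (16126, -13022) 985,
    Tube 0 (-470) (-22644314) 44578414 (24958, 46062267) (890164, -921328) (-19137, 16324) (-40549, -5381) (8926, -9238) 213,
    Tube 0 (-235) (-11642149) 48625717 (-45963, 23429079) (365657, -524507) (-10447, 8690) (-64618, -23682) (3849, -5520) 70,
    Tube 0 (-118) (-5886318) 49652304 (18617, 11764580) (18953, -346704) (-6759, 3688) (-120395, -55414) (207, -3769) 14,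
    Tube 0 (-59) (-2948289) 49913000 (6123, 5887506) (-318340, -337293) (-6427, 332) (-236820, -115796) (-3517, -3726) 41,
    Tube 0 (-30) (-1499775) 49977502 (48396, 2942273) (-814526, -496186) (-9288, -2861) (-473768, -235466) (-9593, -5845) 115,
    Tube 0 (-15) (-749972) 49994375 (15081, 1466685) (-1717792, -903266) (-16741, -7453) (-957385, -477922) (-26862, -14126) 346,
    Tube 0 (-8) 0 0 (39334, 724253) (-3479857, -1762065) (-32453, -15712) (-2003251, -1001195) (-134078, -67892) 0]"

text \<open>
  The bond orbit has no point at \<open>\<pi>\<close>; the base points \<open>2417\<close> and \<open>- 2416\<close>, the latter after a full turn has been subtracted, approximate the pair that is
  symmetric about \<open>\<pi>\<close>.
\<close>

definition bond_tubes :: "tube list" where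
  "bond_tubes =
   [Tube 0 5 249999 49999375 (20600, 260300) (11000, 5500) (0, 0) (800000, -800000) (20, 10) 20,
    Tube 0 10 499992 49997500 (41199, 520599) (22000, 11000) (0, 0) (402017, -402027) (68, 35) 13,
    Tube 0 21 1049923 49988975 (-17612, 1041189) (43999, 21999) (0, 0) (202008, -202049) (157, 79) 10,
    Tube 0 42 2099383 49955906 (-35304, 2082308) (87993, 43994) (0, 0) (101457, -101584) (331, 166) 11,
    Tube 0 83 4145237 49827874 (28751, 4164055) (175945, 87952) (-1, -1) (50822, -51167) (682, 342) 14,
    Tube 0 167 8311242 49304394 (-47631, 8323618) (351567, 175622) (-9, -8) (25119, -25989) (1391, 696) 31,
    Tube 0 333 16343985 47253298 (-36255, 16611376) (700527, 348960) (-73, -64) (11602, -13707) (2829, 1410) 70,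
    Tube 0 662 30734780 39438221 (1974, 32938229) (1380509, 679982) (-573, -500) (3432, -8355) (5688, 2802) 79,
    Tube 0 1299 48164510 13423113 (-24238, 63673788) (2604939, 1224430) (-4228, -3655) (-3667, -7192) (10946, 5146) 706,
    Tube 0 2417 33141524 (-37438474) (10807, 111835045) (4179033, 1574094) (-24792, -20564) (-14664, -9927) (21611, 8141) 1651,
    Tube 1 (-2416) (-33178946) (-37405314) (-35201, 144972523) (4188561, 9528) (-65014, -40222) (-26432, -6141) (30656, 71) 2918,
    Tube 0 (-1298) (-48151063) 13471270 (-28457, 111806744) (2631345, -1557216) (-51813, 13201) (-33746, 5574) (27361, -16193) 2024,
    Tube 0 (-662) (-30734780) 39438221 (23390, 63651847) (1428605, -1202740) (-28922, 22891) (-37508, 1180) (17520, -14751) 526,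
    Tube 0 (-333) (-16343985) 47253298 (49682, 32926292) (789281, -639324) (-14301, 14621) (-52268, -13919) (10352, -8385) 189,
    Tube 0 (-166) (-8261933) 49312680 (-44535, 16605783) (522918, -266363) (-5929, 8372) (-91648, -38942) (7184, -3660) 83,
    Tube 0 (-83) (-4145237) 49827874 (-22646, 8321889) (514420, -8498) (-368, 5561) (-176837, -84641) (7354, -123) 63,
    Tube 0 (-42) (-2099383) 49955906 (42722, 4165368) (762247, 247827) (5064, 5432) (-351844, -173869) (11517, 3746) 104,
    Tube 0 (-21) (-1049923) 49988975 (30049, 2087327) (1390861, 628614) (13087, 8023) (-708273, -353022) (24476, 11063) 236,
    Tube 0 (-10) (-499992) 49997500 (-17526, 1052425) (2714752, 1323891) (27754, 14667) (-1452085, -725432) (77834, 37958) 940,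
    Tube 0 (-5) 0 0 (26144, 543670) (5395951, 2681199) (56482, 28728) (-3389950, -1694598) (627982, 312039) 0]"

text \<open>
  The initial strip is centred at \<open>Y = c / 10 ^ 8\<close> on the expanding axis and has half-width \<open>e / 10 ^ 8\<close> in \<open>Y\<close>;
  along that axis \<open>ucoord\<close> is \<open>3 Y\<close>.
\<close>

definition loop_ok :: "int \<Rightarrow> int \<Rightarrow> nat \<Rightarrow> tube list \<Rightarrow> bool" where
  "loop_ok c e n L \<longleftrightarrow> length L = n + 1 \<and> entry_ok c e (hd L) \<and> chain_ok L \<and> exit_ok (last L) \<and>
     sum_list (map turn (tl L)) = 1"

lemma return_branch_if_loop_ok:
  assumes "loop_ok c e n L"
  shows "return_branch n 1
    (3 * (real_of_int c - real_of_int e) / 10 ^ 8) (3 * (real_of_int c + real_of_int e) / 10 ^ 8)"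
proof -
  obtain T ts where "L = T # ts" using assms by (cases L) (auto simp: loop_ok_def)
  with assms show ?thesis
    using return_branch_if_chain_ok[of c e T ts 1] by (simp add: loop_ok_def)
qed

lemma site_loop_ok: "loop_ok 368300 7500 18 site_tubes"
  by code_simp

lemma bond_loop_ok: "loop_ok 260300 5500 19 bond_tubes"
  by code_simp

lemma return_branch_site: "return_branch 18 1 (10824 / 10 ^ 6) (11274 / 10 ^ 6)"
  using return_branch_if_loop_ok[OF site_loop_ok] by simp

lemma return_branch_bond: "return_branch 19 1 (7644 / 10 ^ 6) (7974 / 10 ^ 6)"
  using return_branch_if_loop_ok[OF bond_loop_ok] by simp

definition branches :: "branch set" where
  "branches = {(1, 0, - 62 / 10 ^ 4, 62 / 10 ^ 4),
     (18, 1, 10824 / 10 ^ 6, 11274 / 10 ^ 6), (18, - 1, - (11274 / 10 ^ 6), - (10824 / 10 ^ 6)),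
     (19, 1, 7644 / 10 ^ 6, 7974 / 10 ^ 6), (19, - 1, - (7974 / 10 ^ 6), - (7644 / 10 ^ 6))}"

lemma branches_return:
  assumes "(n, m, lo, hi) \<in> branches"
  shows "return_branch n m lo hi"
  using assms unfolding branches_def insert_iff empty_iff prod.inject
  by (elim disjE conjE FalseE; simp only: return_branch_saddle return_branch_site return_branch_bond
      return_branch_site[THEN return_branch_uminus] return_branch_bond[THEN return_branch_uminus])

text \<open>
  The cubic Taylor polynomial of the exponential function is a lower bound, since the quartic
  remainder is positive.
\<close>

lemma exp_lower_bound: "exp (- 0.1732515918346) \<ge> (8408 / 10 ^ 4 :: real)"
proof -
  let ?x = "- 0.1732515918346 :: real"
  obtain t where "exp ?x = (\<Sum>m<4. ?x ^ m / fact m) + exp t / fact 4 * ?x ^ 4"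
    using Maclaurin_exp_le by blast
  then have "(\<Sum>m<4. ?x ^ m / fact m) \<le> exp ?x" by simp
  moreover have "8408 / 10 ^ 4 \<le> (\<Sum>m<4. ?x ^ m / fact m)"
    by (simp add: eval_nat_numeral lessThan_Suc)
  ultimately show ?thesis by linarith
qed

theorem theorem4p2:
  "topological_entropy (standard_map (1/2)) \<ge> ereal 0.1732515918346"
proof (rule entropy_ge_return_words[OF compact_torus continuous_standard_map, where I = branches
      and N = fst and E = "\<lambda>b. torus_point ` strip b" and \<delta> = "1 / 10 ^ 3 / 30"])
  show "finite branches" by (simp add: branches_def)
  show "fst b > 0" if "b \<in> branches" for b using that by (auto simp: branches_def)
  \<comment> \<open>Neighbouring strips are more than \<open>1 / 10 ^ 3\<close> apart in \<open>ucoord\<close>.\<close>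
  show "dist x y > 1 / 10 ^ 3 / 30"
    if b: "b \<in> branches" "b' \<in> branches" "b \<noteq> b'"
      and xy: "x \<in> torus_point ` strip b" "y \<in> torus_point ` strip b'" for b b' x y
  proof -
    obtain p q where p: "p \<in> strip b" "x = torus_point p" and q: "q \<in> strip b'" "y = torus_point q"
      using xy by blast
    have "p \<in> saddle_box" using p(1) by (cases b) simp
    moreover have "q \<in> saddle_box" using q(1) by (cases b') simp
    moreover have "1 / 10 ^ 3 \<le> \<bar>ucoord p - ucoord q\<bar>"
      using b p(1) q(1) unfolding branches_def by (auto simp: abs_if)
    ultimately show ?thesis unfolding p(2) q(2) by (intro dist_torus_point_ge) simp_all
  qed
  show "\<exists>x. follows (\<lambda>i. standard_map (1/2) ^^ fst i) (\<lambda>b. torus_point ` strip b) x w" if "w \<in> lists branches" for w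
  proof -
    \<comment> \<open>The expanding axis of the box, parametrized by \<open>ucoord\<close>.\<close>
    define \<gamma> where "\<gamma> t = (2 * t / 3, t / 3)" for t :: real
    have on_line: "ucoord (\<gamma> t) = t" "vcoord (\<gamma> t) = 0" for t by (simp_all add: ucoord_def vcoord_def \<gamma>_def)
    have "\<exists>t\<in>{- 12 / 10 ^ 3..12 / 10 ^ 3}. follows return_map strip (\<gamma> t) w"
    proof (rule itinerary_on_crossing_curve[OF branches_return _ that])
      show "- 12 / 10 ^ 3 \<le> lo \<and> lo \<le> hi \<and> hi \<le> 12 / 10 ^ 3" if "(n, m, lo, hi) \<in> branches" for n m lo hi
        using that by (auto simp: branches_def)
      show "continuous_on {- 12 / 10 ^ 3..12 / 10 ^ 3} \<gamma>" unfolding \<gamma>_def by (intro continuous_intros) auto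
      show "\<gamma> ` {- 12 / 10 ^ 3..12 / 10 ^ 3} \<subseteq> saddle_box" by (auto simp: saddle_box_def on_line abs_le_iff)
    qed (simp_all add: on_line)
    then obtain t where "follows return_map strip (\<gamma> t) w" by blast
    from follows_image[OF this, of torus_point, OF torus_point_return_map] show ?thesis by blast
  qed
  have "1 \<le> 8408 / 10 ^ 4 + 2 * (8408 / 10 ^ 4) ^ 18 + 2 * (8408 / 10 ^ 4 :: real) ^ 19"
    by (simp add: power_divide)
  also have "\<dots> \<le> exp (- 0.1732515918346) + 2 * exp (- 0.1732515918346) ^ 18 + 2 * exp (- 0.1732515918346 :: real) ^ 19"
    using exp_lower_bound by (intro add_mono mult_left_mono power_mono) simp_all
  also have "\<dots> = (\<Sum>b\<in>branches. exp (- 0.1732515918346 * fst b))"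
    by (simp add: branches_def exp_of_nat_mult[symmetric] mult.commute)
  finally show "1 \<le> (\<Sum>b\<in>branches. exp (- 0.1732515918346 * fst b))" .
qed simp_all

end
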